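(* Let $1\le p<\infty$ and let $v:\Delta(\tfrac{\pi}{4})\to\mathbb{R}$ be given by $v(x+iy)=e^{2y}$. Then $v$ is an admissible weight function, and the translation $C_0$-semigroup $\mathcal{T}=\{T_t\}_{t\in\Delta(\frac{\pi}{4})}$ on $X=L^p_v(\Delta(\tfrac{\pi}{4}))$ is Devaney chaotic but not distributionally chaotic.
   Context: The complex sector is $\Delta=\Delta(\tfrac{\pi}{4})=\{re^{i\theta}\in\mathbb{C}: r\ge 0,\ |\theta|\le\tfrac{\pi}{4}\}$; $\Delta_r=\{t\in\Delta:|t|<r\}$ for $r>0$. With $\mu$ the (planar) Lebesgue measure, the upper density of a measurable $A\subset\Delta$ is $\overline{\mathrm{dens}}(A)=\limsup_{r\to\infty}\mu(A\cap\Delta_r)/\mu(\Delta_r)$. A measurable function $v:\Delta\to\mathbb{R}$ is an admissible weight function if $v(t)>0$ for all $t\in\Delta$ and there are constants $M\ge1$, $w\in\mathbb{R}$ with $v(t)\le Me^{w|t'|}v(t+t')$ for all $t,t'\in\Delta$. For $\mathbb{K}=\mathbb{R}$ or $\mathbb{C}$, $L^p_v(\Delta)$ is the Banach space of (classes of) measurable $f:\Delta\to\mathbb{K}$ with $\|f\|=\left(\int_\Delta|f(t)|^pv(t)\,dt\right)^{1/p}<\infty$. The translation semigroup is $(T_tf)(s)=f(s+t)$ for $s,t\in\Delta$; for an admissible weight it is a $C_0$-semigroup (i.e. $T_0=I$, $T_tT_s=T_{t+s}$, and $t\mapsto T_tf$ is norm continuous for each $f$). $\mathcal{T}$ is hypercyclic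 if there is $f\in X$ whose orbit $\{T_tf:t\in\Delta\}$ is dense in $X$; $f\in X$ is a periodic point if $T_tf=f$ for some $t\in\Delta\setminus\{0\}$; $\mathcal{T}$ is Devaney chaotic if it is hypercyclic and its set of periodic points is dense in $X$. A pair $(f,g)\in X\times X$ is distributionally chaotic if there is $\delta>0$ such that $\overline{\mathrm{dens}}(\{t\in\Delta:\|T_tf-T_tg\|<\varepsilon\})=1$ for every $\varepsilon>0$ and $\overline{\mathrm{dens}}(\{t\in\Delta:\|T_tf-T_tg\|>\delta\})=1$. $\mathcal{T}$ is distributionally chaotic if there is an uncountable set $S\subset X$ such that any two distinct points of $S$ form a distributionally chaotic pair. *)

theory Defs
  imports "HOL-Analysis.Analysis"
begin

section \<open>The sector and upper densities\<close>

definition sector :: "real \<Rightarrow> complex set" where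
  "sector \<alpha> = {complex_of_real r * cis \<theta> |r \<theta>. 0 \<le> r \<and> \<bar>\<theta>\<bar> \<le> \<alpha>}"

abbreviation Delta :: "complex set" (\<open>\<Delta>\<close>) where
  "\<Delta> \<equiv> sector (pi / 4)"

definition Delta_below :: "real \<Rightarrow> complex set" where
  "Delta_below r = {t \<in> \<Delta>. norm t < r}"

definition upper_density :: "complex set \<Rightarrow> ereal" where
  "upper_density A =
     Limsup at_top (\<lambda>r::real.
       ereal (measure lebesgue (A \<inter> Delta_below r) / measure lebesgue (Delta_below r)))"

section \<open>Semigroups indexed by the sector on a normed space with explicit carrier\<close>

text \<open>
  The weighted Lebesgue spaces depend on a weight and an exponent, so they cannot be types;
  a normed space over \<open>'k\<close> is represented by its carrier together with its operations.
\<close>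

record ('k, 'x) normed_space =
  vecs :: "'x set"
  vplus :: "'x \<Rightarrow> 'x \<Rightarrow> 'x"
  vscale :: "'k \<Rightarrow> 'x \<Rightarrow> 'x"
  vnorm :: "'x \<Rightarrow> real"

definition vdist :: "('k::real_normed_field, 'x) normed_space \<Rightarrow> 'x \<Rightarrow> 'x \<Rightarrow> real" where
  "vdist X f g = vnorm X (vplus X f (vscale X (- 1) g))"

definition dense_in :: "('k::real_normed_field, 'x) normed_space \<Rightarrow> 'x set \<Rightarrow> bool" where
  "dense_in X D \<longleftrightarrow> D \<subseteq> vecs X \<and> (\<forall>f\<in>vecs X. \<forall>\<epsilon>>0. \<exists>g\<in>D. vdist X f g < \<epsilon>)"

definition bounded_operator ::
    "('k::real_normed_field, 'x) normed_space \<Rightarrow> ('x \<Rightarrow> 'x) \<Rightarrow> bool" where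
  "bounded_operator X A \<longleftrightarrow>
     (\<forall>f\<in>vecs X. A f \<in> vecs X) \<and>
     (\<forall>f\<in>vecs X. \<forall>g\<in>vecs X. A (vplus X f g) = vplus X (A f) (A g)) \<and>
     (\<forall>c. \<forall>f\<in>vecs X. A (vscale X c f) = vscale X c (A f)) \<and>
     (\<exists>C. \<forall>f\<in>vecs X. vnorm X (A f) \<le> C * vnorm X f)"

definition C0_semigroup ::
    "('k::real_normed_field, 'x) normed_space \<Rightarrow> (complex \<Rightarrow> 'x \<Rightarrow> 'x) \<Rightarrow> bool" where
  "C0_semigroup X T \<longleftrightarrow>
     (\<forall>t\<in>\<Delta>. bounded_operator X (T t)) \<and>
     (\<forall>f\<in>vecs X. T 0 f = f) \<and>
     (\<forall>t\<in>\<Delta>. \<forall>s\<in>\<Delta>. \<forall>f\<in>vecs X. T t (T s f) = T (t + s) f) \<and>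
     (\<forall>f\<in>vecs X. \<forall>t\<in>\<Delta>. ((\<lambda>s. vdist X (T s f) (T t f)) \<longlongrightarrow> 0) (at t within \<Delta>))"

definition hypercyclic ::
    "('k::real_normed_field, 'x) normed_space \<Rightarrow> (complex \<Rightarrow> 'x \<Rightarrow> 'x) \<Rightarrow> bool" where
  "hypercyclic X T \<longleftrightarrow> (\<exists>f\<in>vecs X. dense_in X {T t f |t. t \<in> \<Delta>})"

definition periodic_points ::
    "('k::real_normed_field, 'x) normed_space \<Rightarrow> (complex \<Rightarrow> 'x \<Rightarrow> 'x) \<Rightarrow> 'x set" where
  "periodic_points X T = {f \<in> vecs X. \<exists>t\<in>\<Delta> - {0}. T t f = f}"

definition devaney_chaotic ::
    "('k::real_normed_field, 'x) normed_space \<Rightarrow> (complex \<Rightarrow> 'x \<Rightarrow> 'x) \<Rightarrow> bool" where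
  "devaney_chaotic X T \<longleftrightarrow> hypercyclic X T \<and> dense_in X (periodic_points X T)"

definition distributionally_chaotic_pair ::
    "('k::real_normed_field, 'x) normed_space \<Rightarrow> (complex \<Rightarrow> 'x \<Rightarrow> 'x) \<Rightarrow> 'x \<Rightarrow> 'x \<Rightarrow> bool" where
  "distributionally_chaotic_pair X T f g \<longleftrightarrow>
     (\<exists>\<delta>>0.
        (\<forall>\<epsilon>>0. upper_density {t \<in> \<Delta>. vdist X (T t f) (T t g) < \<epsilon>} = 1) \<and>
        upper_density {t \<in> \<Delta>. vdist X (T t f) (T t g) > \<delta>} = 1)"

definition distributionally_chaotic ::
    "('k::real_normed_field, 'x) normed_space \<Rightarrow> (complex \<Rightarrow> 'x \<Rightarrow> 'x) \<Rightarrow> bool" where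
  "distributionally_chaotic X T \<longleftrightarrow>
     (\<exists>S\<subseteq>vecs X. uncountable S \<and>
        (\<forall>f\<in>S. \<forall>g\<in>S. f \<noteq> g \<longrightarrow> distributionally_chaotic_pair X T f g))"

section \<open>Weighted Lebesgue spaces on the sector\<close>

definition admissible_weight :: "(complex \<Rightarrow> real) \<Rightarrow> bool" where
  "admissible_weight v \<longleftrightarrow>
     v \<in> borel_measurable (lebesgue_on \<Delta>) \<and>
     (\<forall>t\<in>\<Delta>. 0 < v t) \<and>
     (\<exists>M\<ge>1. \<exists>w::real. \<forall>t\<in>\<Delta>. \<forall>t'\<in>\<Delta>. v t \<le> M * exp (w * norm t') * v (t + t'))"

text \<open>
  Functions on the sector are total functions on the complex plane whose values off the sector
  are irrelevant: everything below refers to \<open>lebesgue_on \<Delta>\<close> only, and almost everywhere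
  equality identifies functions that differ only off the sector.
\<close>

definition Lp_functions ::
    "real \<Rightarrow> (complex \<Rightarrow> real) \<Rightarrow> (complex \<Rightarrow> 'k::real_normed_field) set" where
  "Lp_functions p v =
     {f \<in> borel_measurable (lebesgue_on \<Delta>).
        integrable (lebesgue_on \<Delta>) (\<lambda>t. norm (f t) powr p * v t)}"

definition Lp_rel ::
    "real \<Rightarrow> (complex \<Rightarrow> real) \<Rightarrow> ((complex \<Rightarrow> 'k::real_normed_field) \<times> (complex \<Rightarrow> 'k)) set" where
  "Lp_rel p v =
     {(f, g). f \<in> Lp_functions p v \<and> g \<in> Lp_functions p v \<and> (AE t in lebesgue_on \<Delta>. f t = g t)}"

definition Lp_fun_norm ::
    "real \<Rightarrow> (complex \<Rightarrow> real) \<Rightarrow> (complex \<Rightarrow> 'k::real_normed_field) \<Rightarrow> real" where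
  "Lp_fun_norm p v f = (LINT t|lebesgue_on \<Delta>. norm (f t) powr p * v t) powr (1 / p)"

text \<open>
  The vectors are the equivalence classes. The operations are those of representatives, lifted
  to the quotient with the union idiom of \<^theory>\<open>HOL.Equiv_Relations\<close>; the norm takes the same
  value on all representatives of a class.
\<close>

definition Lp ::
    "real \<Rightarrow> (complex \<Rightarrow> real) \<Rightarrow> ('k::real_normed_field, (complex \<Rightarrow> 'k) set) normed_space" where
  "Lp p v =
     \<lparr>vecs = Lp_functions p v // Lp_rel p v,
      vplus = (\<lambda>F G. \<Union>f\<in>F. \<Union>g\<in>G. Lp_rel p v `` {\<lambda>s. f s + g s}),
      vscale = (\<lambda>c F. \<Union>f\<in>F. Lp_rel p v `` {\<lambda>s. c * f s}),
      vnorm = (\<lambda>F. the_elem (Lp_fun_norm p v ` F))\<rparr>"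

definition translation ::
    "real \<Rightarrow> (complex \<Rightarrow> real) \<Rightarrow> complex \<Rightarrow> (complex \<Rightarrow> 'k::real_normed_field) set
       \<Rightarrow> (complex \<Rightarrow> 'k) set" where
  "translation p v t F = (\<Union>f\<in>F. Lp_rel p v `` {\<lambda>s. f (s + t)})"

end

(*
  Since the weight exp (2 Im s) is multiplicative, ||T_t f||^p is exp (-2 Im t) times the weighted
  integral of |f|^p over t + Delta. All estimates use the p-th power of the norm, for which
  |a + b|^p <= 2^p (|a|^p + |b|^p) replaces Minkowski's inequality.

  Moving f along the lower boundary ray, by a (1 - i) with a large, makes its norm small. Copies
  g_n(s - a_n (1 - i)) of functions with bounded support can be given disjoint supports and
  summable norms; translating the sum by a_m (1 - i) pushes all earlier copies out of the sector
  and leaves g_m up to a small tail. With g_n running infinitely often through a countable dense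
  family the sum has a dense orbit; with a constant sequence g_n and a_n = n c it is a periodic
  point close to g_0.

  In the upper half of the sector the norms ||T_t (f - g)|| tend to zero as Im t grows, so
  {t : ||T_t f - T_t g|| > delta} lies below some horizontal line and has upper density < 1.
*)
theory Submission
  imports Defs
begin

section \<open>The sector\<close>

text \<open>Hypercyclicity and periodicity can be produced by one direction of the sector, whereas
  distributional chaos measures all directions at once; the weight separates the two. Along
  \<open>1 - i\<close> the bound \<open>exp (- 2 * Im t)\<close> on the mass grows, which leaves
  room for large orbits, but the upper half of every \<open>Delta_below r\<close> has half its area,
  and there the same bound decays. The lower boundary ray interacts well with real parts: a function
  on the sector that vanishes for \<open>R \<le> Re s\<close> has bounded support, and translating
  by at least \<open>R\<close> along the ray pushes it out completely. Disjointness of copies is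
  therefore a statement about intervals of real parts. Translation invariance holds on the whole
  plane and not on the sector, so functions are extended by zero before they are moved; cutting back
  to the sector only loses mass. Avoiding Minkowski costs a factor \<open>2 powr p\<close> per
  triangle inequality. This is the origin of the constants
  \<open>\<epsilon> / (4 * 2 powr p)\<close>, and infinite sums have to be estimated through
  disjoint supports instead. The sort \<open>{real_normed_field, euclidean_space}\<close> treats
  real and complex scalars together.\<close>

lemma mem_Delta_iff: "t \<in> \<Delta> \<longleftrightarrow> \<bar>Im t\<bar> \<le> Re t"
proof
  assume "t \<in> \<Delta>"
  then obtain r \<theta> where t: "t = complex_of_real r * cis \<theta>" and r: "0 \<le> r"
    and \<theta>: "\<bar>\<theta>\<bar> \<le> pi / 4"
    unfolding sector_def by blast
  have "\<bar>sin \<theta>\<bar> = sin \<bar>\<theta>\<bar>"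
    using \<theta> sin_ge_zero[of "\<bar>\<theta>\<bar>"] pi_gt_zero by (cases "\<theta> \<ge> 0") auto
  also have "\<dots> \<le> sin (pi / 4)"
    using \<theta> pi_gt_zero by (intro sin_monotone_2pi_le) auto
  also have "\<dots> = cos (pi / 4)"
    by (simp add: sin_45 cos_45)
  also have "\<dots> \<le> cos \<bar>\<theta>\<bar>"
    using \<theta> pi_gt_zero by (intro cos_monotone_0_pi_le) auto
  finally have "\<bar>sin \<theta>\<bar> \<le> cos \<theta>" by simp
  with r show "\<bar>Im t\<bar> \<le> Re t"
    by (simp add: t abs_mult mult_left_mono)
next
  assume le: "\<bar>Im t\<bar> \<le> Re t"
  show "t \<in> \<Delta>"
  proof (cases "t = 0")
    case True
    then show ?thesis
      unfolding sector_def by (intro CollectI exI[of _ 0]) simp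
  next
    case False
    with le have pos: "Re t > 0"
      by (metis abs_ge_zero abs_le_zero_iff complex_eq_iff less_eq_real_def order_trans zero_complex.simps)
    have "Im t / Re t \<le> 1" "- 1 \<le> Im t / Re t"
      using le pos by (simp_all add: field_simps abs_le_iff)
    then have "\<bar>arctan (Im t / Re t)\<bar> \<le> pi / 4"
      using arctan_le_iff[of "Im t / Re t" 1] arctan_le_iff[of "-1" "Im t / Re t"]
      by (simp add: arctan_one arctan_minus abs_if)
    then have "\<bar>Arg t\<bar> \<le> pi / 4"
      using arg_conv_arctan[OF pos] by simp
    moreover have "t = complex_of_real (norm t) * cis (Arg t)"
      using False by (metis rcis_cmod_Arg rcis_def)
    ultimately show ?thesis
      unfolding sector_def by (intro CollectI exI[of _ "norm t"] exI[of _ "Arg t"]) simp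
  qed
qed

lemma zero_in_Delta: "0 \<in> \<Delta>"
  by (simp add: mem_Delta_iff)

lemma Delta_add: "s \<in> \<Delta> \<Longrightarrow> t \<in> \<Delta> \<Longrightarrow> s + t \<in> \<Delta>"
  unfolding mem_Delta_iff by (simp add: abs_le_iff)

lemma closed_Delta: "closed \<Delta>"
proof -
  have "\<Delta> = {t. \<bar>Im t\<bar> \<le> Re t}"
    by (auto simp: mem_Delta_iff)
  then show ?thesis
    by (auto intro!: closed_Collect_le continuous_intros)
qed

lemma sets_Delta [measurable, simp]: "\<Delta> \<in> sets lebesgue"
  using closed_Delta by (simp add: borel_closed)

lemma space_Delta [simp]: "space (lebesgue_on \<Delta>) = \<Delta>"
  by (simp add: space_restrict_space)

lemma borel_measurable_lebesgue_on_Delta: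
  "f \<in> borel_measurable borel \<Longrightarrow> f \<in> borel_measurable (lebesgue_on \<Delta>)"
  by (simp add: measurable_completion measurable_restrict_space1)

section \<open>Translating Lebesgue measure\<close>

lemma lebesgue_translation:
  fixes w :: "'a::euclidean_space"
  shows "lebesgue = distr lebesgue lebesgue (\<lambda>x. x + w)"
    and "(\<lambda>x. x + w) \<in> lebesgue \<rightarrow>\<^sub>M lebesgue"
proof -
  \<comment> \<open>The affine change of variables is stated coordinatewise with scaling factors; a
    translation is the case in which all factors, and hence the density, are 1.\<close>
  have "(\<lambda>x. x + w) = (\<lambda>x. w + (\<Sum>j\<in>Basis. (1 * (x \<bullet> j)) *\<^sub>R j))"
    by (simp add: euclidean_representation add.commute)
  then show "lebesgue = distr lebesgue lebesgue (\<lambda>x. x + w)"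
    and "(\<lambda>x. x + w) \<in> lebesgue \<rightarrow>\<^sub>M lebesgue"
    using lebesgue_affine_euclidean[of "\<lambda>_. 1" w] lebesgue_affine_measurable[of "\<lambda>_. 1" w]
    by (simp_all add: density_1)
qed

lemma nn_integral_translation:
  fixes g :: "'a::euclidean_space \<Rightarrow> ennreal"
  assumes "g \<in> borel_measurable lebesgue"
  shows "(\<integral>\<^sup>+ x. g (x + w) \<partial>lebesgue) = (\<integral>\<^sup>+ x. g x \<partial>lebesgue)"
proof -
  have "(\<integral>\<^sup>+ x. g x \<partial>lebesgue) = (\<integral>\<^sup>+ x. g x \<partial>distr lebesgue lebesgue (\<lambda>x. x + w))"
    using lebesgue_translation(1)[of w] by simp
  also have "\<dots> = (\<integral>\<^sup>+ x. g (x + w) \<partial>lebesgue)"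
    using assms by (intro nn_integral_distr lebesgue_translation(2)) auto
  finally show ?thesis ..
qed

section \<open>The weighted mass\<close>

text \<open>Extended-valued, so that estimates can be written before finiteness is known; for
  measurable functions finiteness is membership in the weighted space.\<close>

definition mass :: "real \<Rightarrow> (complex \<Rightarrow> 'k::real_normed_vector) \<Rightarrow> ennreal" where
  "mass p f = (\<integral>\<^sup>+ s. ennreal (norm (f s) powr p * exp (2 * Im s)) \<partial>lebesgue_on \<Delta>)"

lemma borel_measurable_weight [measurable]:
  "(\<lambda>s. exp (2 * Im s)) \<in> borel_measurable (lebesgue_on \<Delta>)"
  by (rule borel_measurable_lebesgue_on_Delta) (intro borel_measurable_continuous_onI continuous_intros)

lemma mass_cong:
  "(\<And>s. s \<in> \<Delta> \<Longrightarrow> norm (f s) = norm (g s)) \<Longrightarrow> mass p f = mass p g"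
  unfolding mass_def by (rule nn_integral_cong) simp

lemma mass_cong_AE:
  "AE s in lebesgue_on \<Delta>. f s = g s \<Longrightarrow> mass p f = mass p g"
  unfolding mass_def by (rule nn_integral_cong_AE) auto

text \<open>Twice the larger norm bounds the norm of the sum, so no convexity enters and every
  \<open>0 \<le> p\<close> is covered.\<close>

lemma norm_add_powr_le:
  assumes "0 \<le> p"
  shows "norm (a + b) powr p \<le> 2 powr p * (norm a powr p + norm b powr p)"
proof -
  have "norm (a + b) powr p \<le> (2 * max (norm a) (norm b)) powr p"
    using assms norm_triangle_ineq[of a b] by (intro powr_mono2) auto
  also have "\<dots> = 2 powr p * max (norm a) (norm b) powr p"
    by (simp add: powr_mult)
  also have "\<dots> \<le> 2 powr p * (norm a powr p + norm b powr p)"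
    by (intro mult_left_mono) (auto simp: max_def)
  finally show ?thesis .
qed

lemma mass_add_le:
  fixes f g :: "complex \<Rightarrow> 'k::{second_countable_topology, real_normed_vector}"
  assumes p: "0 \<le> p"
    and [measurable]: "f \<in> borel_measurable (lebesgue_on \<Delta>)" "g \<in> borel_measurable (lebesgue_on \<Delta>)"
  shows "mass p (\<lambda>s. f s + g s) \<le> ennreal (2 powr p) * (mass p f + mass p g)"
proof -
  have "mass p (\<lambda>s. f s + g s) \<le> (\<integral>\<^sup>+ s. ennreal (2 powr p) *
      (ennreal (norm (f s) powr p * exp (2 * Im s)) + ennreal (norm (g s) powr p * exp (2 * Im s)))
      \<partial>lebesgue_on \<Delta>)"
    unfolding mass_def
  proof (rule nn_integral_mono)
    fix s
    have "norm (f s + g s) powr p * exp (2 * Im s)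
        \<le> 2 powr p * (norm (f s) powr p * exp (2 * Im s) + norm (g s) powr p * exp (2 * Im s))"
      using mult_right_mono[OF norm_add_powr_le[OF p, of "f s" "g s"], of "exp (2 * Im s)"]
      by (simp add: algebra_simps)
    then show "ennreal (norm (f s + g s) powr p * exp (2 * Im s)) \<le> ennreal (2 powr p) *
      (ennreal (norm (f s) powr p * exp (2 * Im s)) + ennreal (norm (g s) powr p * exp (2 * Im s)))"
      by (simp flip: ennreal_mult' ennreal_plus add: ennreal_leI)
  qed
  also have "\<dots> = ennreal (2 powr p) * (mass p f + mass p g)"
    unfolding mass_def by (simp add: nn_integral_cmult nn_integral_add)
  finally show ?thesis .
qed

lemma mass_diff_le:
  fixes f g h :: "complex \<Rightarrow> 'k::{second_countable_topology, real_normed_vector}"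
  assumes p: "0 \<le> p"
    and [measurable]: "f \<in> borel_measurable (lebesgue_on \<Delta>)" "g \<in> borel_measurable (lebesgue_on \<Delta>)"
      "h \<in> borel_measurable (lebesgue_on \<Delta>)"
  shows "mass p (\<lambda>s. f s - h s)
    \<le> ennreal (2 powr p) * (mass p (\<lambda>s. f s - g s) + mass p (\<lambda>s. g s - h s))"
  using mass_add_le[OF p, of "\<lambda>s. f s - g s" "\<lambda>s. g s - h s"] by simp

lemma mass_scale:
  fixes f :: "complex \<Rightarrow> 'k::{second_countable_topology, real_normed_field}"
  assumes [measurable]: "f \<in> borel_measurable (lebesgue_on \<Delta>)"
  shows "mass p (\<lambda>s. c * f s) = ennreal (norm c powr p) * mass p f"
proof -
  have "mass p (\<lambda>s. c * f s) = (\<integral>\<^sup>+ s. ennreal (norm c powr p) *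
      ennreal (norm (f s) powr p * exp (2 * Im s)) \<partial>lebesgue_on \<Delta>)"
    unfolding mass_def
    by (intro nn_integral_cong) (simp add: norm_mult powr_mult mult.assoc flip: ennreal_mult')
  also have "\<dots> = ennreal (norm c powr p) * mass p f"
    unfolding mass_def by (simp add: nn_integral_cmult)
  finally show ?thesis .
qed

section \<open>Measurability and mass of translated functions\<close>

lemma borel_measurable_cutoff_Delta_iff:
  fixes f :: "complex \<Rightarrow> 'k::euclidean_space"
  shows "(\<lambda>s. if s \<in> \<Delta> then f s else 0) \<in> borel_measurable lebesgue
    \<longleftrightarrow> f \<in> borel_measurable (lebesgue_on \<Delta>)"
  by (rule borel_measurable_if) simp

lemma borel_measurable_cutoff_Delta:
  fixes f :: "complex \<Rightarrow> 'k::euclidean_space"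
  assumes "f \<in> borel_measurable (lebesgue_on \<Delta>)"
  shows "(\<lambda>s. if s \<in> \<Delta> then f s else 0) \<in> borel_measurable (lebesgue_on \<Delta>)"
  using assms borel_measurable_cutoff_Delta_iff measurable_restrict_space1 by blast

text \<open>Vanishing off the sector makes \<open>g\<close> measurable on the whole plane, where any
  \<open>w\<close> is allowed. Gluing moves copies by vectors outside the sector, so this generality
  matters.\<close>

lemma borel_measurable_translate:
  fixes g :: "complex \<Rightarrow> 'k::euclidean_space"
  assumes "g \<in> borel_measurable (lebesgue_on \<Delta>)" and zero: "\<And>s. s \<notin> \<Delta> \<Longrightarrow> g s = 0"
  shows "(\<lambda>s. g (s + w)) \<in> borel_measurable (lebesgue_on \<Delta>)"
proof -
  have "g = (\<lambda>s. if s \<in> \<Delta> then g s else 0)"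
    using zero by auto
  then have "g \<in> borel_measurable lebesgue"
    using assms borel_measurable_cutoff_Delta_iff by metis
  then have "(\<lambda>s. g (s + w)) \<in> borel_measurable lebesgue"
    using measurable_compose[OF lebesgue_translation(2)] by blast
  then show ?thesis
    by (rule measurable_restrict_space1)
qed

text \<open>The factor comes from
  \<open>exp (2 * Im s) = exp (- 2 * Im w) * exp (2 * Im (s + w))\<close>. Over the plane this is an
  equality; an inequality remains because mass moved out of the sector is dropped.\<close>

lemma mass_translate_le:
  fixes g :: "complex \<Rightarrow> 'k::euclidean_space"
  assumes g: "g \<in> borel_measurable (lebesgue_on \<Delta>)" and zero: "\<And>s. s \<notin> \<Delta> \<Longrightarrow> g s = 0" and p: "0 < p"
  shows "mass p (\<lambda>s. g (s + w)) \<le> ennreal (exp (- 2 * Im w)) * mass p g"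
proof -
  have "g = (\<lambda>s. if s \<in> \<Delta> then g s else 0)"
    using zero by auto
  then have [measurable]: "g \<in> borel_measurable lebesgue"
    using g borel_measurable_cutoff_Delta_iff by metis
  have [measurable]: "(\<lambda>s. exp (2 * Im s)) \<in> borel_measurable lebesgue"
    by (intro measurable_completion borel_measurable_continuous_onI continuous_intros) simp
  have 0: "(\<lambda>s. ennreal (norm (g s) powr p * exp (2 * Im s))) \<in> borel_measurable lebesgue"
    by measurable
  have "mass p (\<lambda>s. g (s + w))
      \<le> (\<integral>\<^sup>+ s. ennreal (norm (g (s + w)) powr p * exp (2 * Im s)) \<partial>lebesgue)"
    unfolding mass_def
    by (subst nn_integral_restrict_space) (auto intro!: nn_integral_mono split: split_indicator)
  also have "\<dots> = (\<integral>\<^sup>+ s. ennreal (exp (- 2 * Im w)) *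
      ennreal (norm (g (s + w)) powr p * exp (2 * Im (s + w))) \<partial>lebesgue)"
    by (intro nn_integral_cong) (simp add: exp_add exp_minus field_simps flip: ennreal_mult')
  also have "\<dots> = (\<integral>\<^sup>+ s. ennreal (exp (- 2 * Im w)) *
      ennreal (norm (g s) powr p * exp (2 * Im s)) \<partial>lebesgue)"
    by (rule nn_integral_translation[where
          g = "\<lambda>s. ennreal (exp (- 2 * Im w)) * ennreal (norm (g s) powr p * exp (2 * Im s))"])
      measurable
  also have "\<dots> = ennreal (exp (- 2 * Im w)) *
      (\<integral>\<^sup>+ s. ennreal (norm (g s) powr p * exp (2 * Im s)) \<partial>lebesgue)"
    using 0 by (rule nn_integral_cmult)
  also have "(\<integral>\<^sup>+ s. ennreal (norm (g s) powr p * exp (2 * Im s)) \<partial>lebesgue) = mass p g"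
    unfolding mass_def using p zero
    by (subst nn_integral_restrict_space) (auto intro!: nn_integral_cong split: split_indicator)
  finally show ?thesis .
qed

text \<open>For \<open>t\<close> in the sector, \<open>s + t\<close> never leaves it, so
  \<open>f\<close> may be replaced by its extension by zero.\<close>

lemma borel_measurable_translate_Delta:
  fixes f :: "complex \<Rightarrow> 'k::euclidean_space"
  assumes "f \<in> borel_measurable (lebesgue_on \<Delta>)" "t \<in> \<Delta>"
  shows "(\<lambda>s. f (s + t)) \<in> borel_measurable (lebesgue_on \<Delta>)"
proof -
  have "(\<lambda>s. if s + t \<in> \<Delta> then f (s + t) else 0) \<in> borel_measurable (lebesgue_on \<Delta>)"
    using borel_measurable_cutoff_Delta[OF assms(1)] by (rule borel_measurable_translate) simp
  also have "?this \<longleftrightarrow> ?thesis"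
    using assms(2) by (intro measurable_cong) (simp add: Delta_add)
  finally show ?thesis .
qed

lemma mass_translate_Delta_le:
  fixes f :: "complex \<Rightarrow> 'k::euclidean_space"
  assumes "f \<in> borel_measurable (lebesgue_on \<Delta>)" "t \<in> \<Delta>" "0 < p"
  shows "mass p (\<lambda>s. f (s + t)) \<le> ennreal (exp (- 2 * Im t)) * mass p f"
proof -
  let ?g = "\<lambda>s. if s \<in> \<Delta> then f s else 0"
  have "mass p (\<lambda>s. f (s + t)) = mass p (\<lambda>s. ?g (s + t))"
    using assms(2) by (intro mass_cong) (simp add: Delta_add)
  also have "\<dots> \<le> ennreal (exp (- 2 * Im t)) * mass p ?g"
    using borel_measurable_cutoff_Delta[OF assms(1)] assms(3) by (intro mass_translate_le) simp_all
  also have "mass p ?g = mass p f"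
    by (rule mass_cong) simp
  finally show ?thesis .
qed

text \<open>The common tool for truncation, for approximation by continuous and by step functions,
  and for continuity of translations. The majorant bounds the difference directly, which suits
  errors that vanish outside a fixed bounded region.\<close>

lemma mass_dominated_convergence:
  fixes f :: "complex \<Rightarrow> 'k::{second_countable_topology, real_normed_vector}"
    and b :: "complex \<Rightarrow> real"
  assumes p: "0 < p"
    and [measurable]: "f \<in> borel_measurable (lebesgue_on \<Delta>)"
      "\<And>n. g n \<in> borel_measurable (lebesgue_on \<Delta>)" "b \<in> borel_measurable (lebesgue_on \<Delta>)"
    and lim: "AE s in lebesgue_on \<Delta>. (\<lambda>n. g n s) \<longlonglongrightarrow> f s"
    and bound: "\<And>n s. s \<in> \<Delta> \<Longrightarrow> norm (f s - g n s) \<le> b s"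
    and fin: "mass p b < \<infinity>"
  shows "(\<lambda>n. mass p (\<lambda>s. f s - g n s)) \<longlonglongrightarrow> 0"
proof -
  have "(\<lambda>n. mass p (\<lambda>s. f s - g n s)) \<longlonglongrightarrow> (\<integral>\<^sup>+ s. 0 \<partial>lebesgue_on \<Delta>)"
    unfolding mass_def
  proof (rule nn_integral_dominated_convergence[where
        w = "\<lambda>s. ennreal (norm (b s) powr p * exp (2 * Im s))"])
    show "(\<integral>\<^sup>+ s. ennreal (norm (b s) powr p * exp (2 * Im s)) \<partial>lebesgue_on \<Delta>) < \<infinity>"
      using fin unfolding mass_def .
    show "AE s in lebesgue_on \<Delta>. (\<lambda>n. ennreal (norm (f s - g n s) powr p * exp (2 * Im s))) \<longlonglongrightarrow> 0"
      using lim
    proof eventually_elim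
      case (elim s)
      then have "(\<lambda>n. norm (f s - g n s)) \<longlonglongrightarrow> norm (f s - f s)"
        by (intro tendsto_intros)
      then have "(\<lambda>n. norm (f s - g n s) powr p) \<longlonglongrightarrow> 0 powr p"
        using p by (intro tendsto_powr') auto
      then have "(\<lambda>n. norm (f s - g n s) powr p * exp (2 * Im s)) \<longlonglongrightarrow> 0"
        using tendsto_mult_left_zero by fastforce
      then show ?case
        using tendsto_ennrealI by fastforce
    qed
    show "AE s in lebesgue_on \<Delta>. ennreal (norm (f s - g n s) powr p * exp (2 * Im s))
        \<le> ennreal (norm (b s) powr p * exp (2 * Im s))" for n
    proof (rule AE_I2)
      fix s assume "s \<in> space (lebesgue_on \<Delta>)"
      then have "norm (f s - g n s) \<le> norm (b s)"
        using bound[of s n] by simp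
      then show "ennreal (norm (f s - g n s) powr p * exp (2 * Im s))
          \<le> ennreal (norm (b s) powr p * exp (2 * Im s))"
        using p by (intro ennreal_leI mult_right_mono powr_mono2) auto
    qed
  qed measurable
  then show ?thesis by simp
qed

text \<open>In the sector \<open>\<bar>Im s\<bar> \<le> Re s\<close>, so \<open>Re s < R\<close>
  confines \<open>s\<close> to a box, on which the weight is at most
  \<open>exp (2 * R)\<close>.\<close>

lemma mass_bounded_finite:
  fixes f :: "complex \<Rightarrow> 'k::real_normed_vector"
  assumes p: "0 < p"
    and B: "\<And>s. norm (f s) \<le> B" and R: "\<And>s. s \<in> \<Delta> \<Longrightarrow> R \<le> Re s \<Longrightarrow> f s = 0"
  shows "mass p f < \<infinity>"
proof -
  let ?K = "cbox (Complex 0 (- R)) (Complex R R)"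
  have "mass p f \<le> (\<integral>\<^sup>+ s. ennreal (B powr p * exp (2 * R)) * indicator ?K s \<partial>lebesgue_on \<Delta>)"
    unfolding mass_def
  proof (rule nn_integral_mono)
    fix s assume "s \<in> space (lebesgue_on \<Delta>)"
    then have s: "s \<in> \<Delta>" by simp
    show "ennreal (norm (f s) powr p * exp (2 * Im s))
        \<le> ennreal (B powr p * exp (2 * R)) * indicator ?K s"
    proof (cases "R \<le> Re s")
      case True
      then show ?thesis using R[OF s] p by simp
    next
      case False
      with s have "s \<in> ?K" and "Im s \<le> R"
        by (auto simp: mem_Delta_iff in_cbox_complex_iff)
      moreover have "norm (f s) powr p * exp (2 * Im s) \<le> B powr p * exp (2 * R)"
        using B[of s] p \<open>Im s \<le> R\<close> by (intro mult_mono powr_mono2) auto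
      ultimately show ?thesis by (simp add: ennreal_leI)
    qed
  qed
  also have "\<dots> = (\<integral>\<^sup>+ s. ennreal (B powr p * exp (2 * R)) * indicator ?K s * indicator \<Delta> s \<partial>lebesgue)"
    by (subst nn_integral_restrict_space) auto
  also have "\<dots> \<le> (\<integral>\<^sup>+ s. ennreal (B powr p * exp (2 * R)) * indicator ?K s \<partial>lebesgue)"
    by (intro nn_integral_mono) (auto split: split_indicator)
  also have "\<dots> = ennreal (B powr p * exp (2 * R)) * emeasure lebesgue ?K"
    by (subst nn_integral_cmult_indicator) auto
  also have "\<dots> < \<infinity>"
    using emeasure_lborel_cbox_finite[of "Complex 0 (- R)" "Complex R R"]
    by (simp add: ennreal_mult_less_top)
  finally show ?thesis .
qed

text \<open>The two errors and the factor \<open>2 powr p\<close> add up to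
  \<open>\<epsilon> / 2\<close>; the spare factor of two turns non-strict bounds into a strict
  one.\<close>

lemma mass_diff_less:
  fixes f g h :: "complex \<Rightarrow> 'k::{second_countable_topology, real_normed_vector}"
  assumes p: "0 \<le> p" and \<epsilon>: "0 < \<epsilon>"
    and meas: "f \<in> borel_measurable (lebesgue_on \<Delta>)" "g \<in> borel_measurable (lebesgue_on \<Delta>)"
      "h \<in> borel_measurable (lebesgue_on \<Delta>)"
    and le: "mass p (\<lambda>s. f s - g s) \<le> ennreal (\<epsilon> / (4 * 2 powr p))"
      "mass p (\<lambda>s. g s - h s) \<le> ennreal (\<epsilon> / (4 * 2 powr p))"
  shows "mass p (\<lambda>s. f s - h s) < ennreal \<epsilon>"
proof -
  have "mass p (\<lambda>s. f s - h s)
      \<le> ennreal (2 powr p) * (ennreal (\<epsilon> / (4 * 2 powr p)) + ennreal (\<epsilon> / (4 * 2 powr p)))"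
    using mass_diff_le[OF p meas] le by (meson add_mono mult_left_mono order_trans zero_le)
  also have "\<dots> = ennreal (2 powr p * (\<epsilon> / (4 * 2 powr p) + \<epsilon> / (4 * 2 powr p)))"
    using \<epsilon> by (simp only: ennreal_mult' ennreal_plus zero_le_divide_iff powr_ge_zero mult_nonneg_nonneg less_imp_le zero_le_numeral simp_thms)
  also have "\<dots> = ennreal (\<epsilon> / 2)"
    by simp
  also have "\<dots> < ennreal \<epsilon>"
    using \<epsilon> by (simp add: ennreal_less_iff)
  finally show ?thesis .
qed

lemma mass_minus_commute: "mass p (\<lambda>s. f s - g s) = mass p (\<lambda>s. g s - f s)"
  by (rule mass_cong) (rule norm_minus_commute)

section \<open>Density of the compactly supported continuous functions\<close>

text \<open>For positive \<open>n\<close>, the radial retraction onto the closed ball of radius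
  \<open>n\<close>; writing it with \<open>max\<close> avoids a case distinction and makes
  continuity immediate.\<close>

definition clip :: "real \<Rightarrow> 'k::real_normed_vector \<Rightarrow> 'k" where
  "clip n z = (n / max n (norm z)) *\<^sub>R z"

definition cutoff :: "real \<Rightarrow> complex \<Rightarrow> real" where
  "cutoff n s = max 0 (min 1 (n + 1 - norm s))"

lemma continuous_on_clip: "0 < n \<Longrightarrow> continuous_on A (clip n)"
  unfolding clip_def by (intro continuous_intros) (auto simp: max_def)

lemma norm_clip_le: "0 < n \<Longrightarrow> norm (clip n z) \<le> n"
  unfolding clip_def by (auto simp: max_def field_simps abs_mult)

lemma clip_eq: "0 < n \<Longrightarrow> norm z \<le> n \<Longrightarrow> clip n z = z"
  unfolding clip_def by (simp add: max_def)

text \<open>The difference is \<open>z\<close> times a factor between 0 and 1. Hence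
  \<open>f\<close> itself dominates all truncation errors.\<close>

lemma norm_diff_clip_le:
  assumes "0 < n" "0 \<le> c" "c \<le> 1"
  shows "norm (z - c *\<^sub>R clip n z) \<le> norm z"
proof -
  have "z - c *\<^sub>R clip n z = (1 - c * (n / max n (norm z))) *\<^sub>R z"
    unfolding clip_def by (simp add: algebra_simps)
  moreover have "0 \<le> c * (n / max n (norm z))" "c * (n / max n (norm z)) \<le> 1 * 1"
    using assms by (simp, intro mult_mono) auto
  ultimately show ?thesis
    by (simp add: mult_left_le_one_le)
qed

lemma cutoff_bounds: "0 \<le> cutoff n s" "cutoff n s \<le> 1"
  unfolding cutoff_def by auto

lemma cutoff_eq_1: "norm s \<le> n \<Longrightarrow> cutoff n s = 1"
  unfolding cutoff_def by simp

lemma cutoff_eq_0: "n + 1 \<le> norm s \<Longrightarrow> cutoff n s = 0"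
  unfolding cutoff_def by simp

lemma continuous_on_cutoff: "continuous_on A (cutoff n)"
  unfolding cutoff_def by (intro continuous_intros)

lemma ennreal_tendsto_0_le:
  fixes u :: "nat \<Rightarrow> ennreal"
  assumes "u \<longlonglongrightarrow> 0" "0 < (\<epsilon>::real)"
  obtains n where "u n \<le> ennreal \<epsilon>"
proof -
  have "eventually (\<lambda>n. u n < ennreal \<epsilon>) sequentially"
    using assms by (intro order_tendstoD(2)[of u 0]) auto
  then show ?thesis
    using that by (auto simp: eventually_sequentially intro: less_imp_le)
qed

lemma ennreal_tendsto_0I:
  fixes u :: "'a \<Rightarrow> ennreal"
  assumes "\<And>\<epsilon>. 0 < (\<epsilon>::real) \<Longrightarrow> eventually (\<lambda>x. u x < ennreal \<epsilon>) F"
  shows "(u \<longlongrightarrow> 0) F"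
proof (rule order_tendstoI)
  fix a :: ennreal assume "0 < a"
  then obtain r where "0 < r" "ennreal r \<le> a"
    by (cases a) (auto intro: that[of 1] that)
  then show "eventually (\<lambda>x. u x < a) F"
    using assms[of r] by (auto elim: eventually_mono)
qed simp

text \<open>Two limits: truncations of \<open>f\<close> in value and support converge to
  \<open>f\<close>, and one fixed truncation is an almost everywhere limit of continuous functions
  truncated in the same way.\<close>

lemma compactly_supported_continuous_dense:
  fixes f :: "complex \<Rightarrow> 'k::euclidean_space"
  assumes p: "0 < p" and \<epsilon>: "0 < (\<epsilon>::real)"
    and f: "f \<in> borel_measurable (lebesgue_on \<Delta>)" and fin: "mass p f < \<infinity>"
  obtains h B R where "continuous_on UNIV h" "\<And>s. norm (h s) \<le> B" "\<And>s. R \<le> norm s \<Longrightarrow> h s = 0"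
    "mass p (\<lambda>s. f s - h s) < ennreal \<epsilon>"
proof -
  define \<eta> where "\<eta> = \<epsilon> / (4 * 2 powr p)"
  have \<eta>: "0 < \<eta>" using \<epsilon> by (simp add: \<eta>_def)
  have clip_meas [measurable]: "clip (real n + 1) \<in> borel_measurable (borel :: 'k measure)" for n
    by (intro borel_measurable_continuous_onI continuous_on_clip) simp
  have cut_meas [measurable]: "cutoff n \<in> borel_measurable (lebesgue_on \<Delta>)" for n
    by (intro borel_measurable_lebesgue_on_Delta borel_measurable_continuous_onI continuous_on_cutoff)
  note f [measurable]
  define F where "F n s = cutoff (real n) s *\<^sub>R clip (real n + 1) (f s)" for n s
  have F [measurable]: "F n \<in> borel_measurable (lebesgue_on \<Delta>)" for n
    unfolding F_def by measurable
  have "(\<lambda>n. mass p (\<lambda>s. f s - F n s)) \<longlonglongrightarrow> 0"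
  proof (rule mass_dominated_convergence[where b = "\<lambda>s. norm (f s)"])
    show "AE s in lebesgue_on \<Delta>. (\<lambda>n. F n s) \<longlonglongrightarrow> f s"
    proof (rule AE_I2)
      fix s
      obtain N where N: "norm (f s) \<le> real N" "norm s \<le> real N"
        using real_arch_simple[of "max (norm (f s)) (norm s)"] by auto
      have "F n s = f s" if "n \<ge> N" for n
        using that N unfolding F_def by (simp add: cutoff_eq_1 clip_eq)
      then show "(\<lambda>n. F n s) \<longlonglongrightarrow> f s"
        by (intro tendsto_eventually) (auto simp: eventually_sequentially)
    qed
    show "norm (f s - F n s) \<le> norm (f s)" for n s
      unfolding F_def by (intro norm_diff_clip_le) (auto simp: cutoff_bounds)
    show "mass p (\<lambda>s. norm (f s)) < \<infinity>"
      using fin mass_cong[of "\<lambda>s. norm (f s)" f p] by simp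
  qed (use p in measurable)
  then obtain n where n: "mass p (\<lambda>s. f s - F n s) \<le> ennreal \<eta>"
    using \<eta> by (rule ennreal_tendsto_0_le)
  \<comment> \<open>By its definition, \<open>measurable_on\<close> supplies continuous functions
    converging to the zero extension of \<open>f\<close> off a negligible set.\<close>
  have "f measurable_on \<Delta>"
    using f by (simp add: measurable_on_iff_borel_measurable)
  then obtain N g where N: "negligible N" and g: "\<And>k. continuous_on UNIV (g k)"
    and lim: "\<And>s. s \<notin> N \<Longrightarrow> (\<lambda>k. g k s) \<longlonglongrightarrow> (if s \<in> \<Delta> then f s else 0)"
    unfolding measurable_on_def by blast
  \<comment> \<open>The approximants \<open>g k\<close> have no common bound or support. Since
    \<open>clip\<close> and \<open>cutoff\<close> are continuous, applying them preserves
    convergence, the limit becomes \<open>F n\<close>, and a majorant independent of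
    \<open>k\<close> appears.\<close>
  define G where "G k s = cutoff (real n) s *\<^sub>R clip (real n + 1) (g k s)" for k s
  have G: "continuous_on UNIV (G k)" for k
    unfolding G_def using g
    by (intro continuous_intros continuous_on_cutoff
        continuous_on_compose2[OF continuous_on_clip[of _ UNIV]]) auto
  have G' [measurable]: "G k \<in> borel_measurable (lebesgue_on \<Delta>)" for k
    using G by (intro borel_measurable_lebesgue_on_Delta borel_measurable_continuous_onI)
  have G_bound: "norm (G k s) \<le> real n + 1" for k s
    using mult_mono[OF cutoff_bounds(2) norm_clip_le[of "real n + 1" "g k s"]]
    by (simp add: G_def cutoff_bounds)
  have F_bound: "norm (F n s) \<le> real n + 1" for s
    using mult_mono[OF cutoff_bounds(2) norm_clip_le[of "real n + 1" "f s"]]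
    by (simp add: F_def cutoff_bounds)
  have "(\<lambda>k. mass p (\<lambda>s. F n s - G k s)) \<longlonglongrightarrow> 0"
  proof (rule mass_dominated_convergence[where b = "\<lambda>s. if norm s \<le> real n + 1 then 2 * (real n + 1) else 0"])
    have "AE s in lebesgue. s \<notin> N"
      using N by (simp add: negligible_iff_null_sets AE_not_in)
    then have "AE s in lebesgue_on \<Delta>. s \<notin> N"
      by (auto simp: AE_restrict_space_iff elim: eventually_mono)
    then show "AE s in lebesgue_on \<Delta>. (\<lambda>k. G k s) \<longlonglongrightarrow> F n s"
    proof (rule AE_mp, intro AE_I2 impI)
      fix s assume "s \<in> space (lebesgue_on \<Delta>)" "s \<notin> N"
      with lim[of s] have "(\<lambda>k. g k s) \<longlonglongrightarrow> f s" by simp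
      moreover have "isCont (clip (real n + 1)) (f s)"
        using continuous_on_clip[of "real n + 1" "UNIV :: 'k set"] by (simp add: continuous_on_eq_continuous_at)
      ultimately show "(\<lambda>k. G k s) \<longlonglongrightarrow> F n s"
        unfolding G_def F_def by (intro tendsto_intros isCont_tendsto_compose[of _ "clip (real n + 1)"])
    qed
    show "norm (F n s - G k s) \<le> (if norm s \<le> real n + 1 then 2 * (real n + 1) else 0)" for k s
      using norm_triangle_ineq4[of "F n s" "G k s"] F_bound[of s] G_bound[of k s]
      by (auto simp: F_def G_def cutoff_eq_0)
    show "mass p (\<lambda>s. if norm s \<le> real n + 1 then 2 * (real n + 1) else 0) < \<infinity>"
    \<comment> \<open>The majorant is still nonzero on the circle of radius \<open>n + 1\<close>;
      hence \<open>n + 2\<close>.\<close>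
    proof (rule mass_bounded_finite[OF p, where R = "real n + 2"])
      show "(if norm s \<le> real n + 1 then 2 * (real n + 1) else 0) = 0" if "real n + 2 \<le> Re s" for s
        using that complex_Re_le_cmod[of s] by auto
    qed (auto intro: order_refl)
    show "(\<lambda>s. if norm s \<le> real n + 1 then 2 * (real n + 1) else 0) \<in> borel_measurable (lebesgue_on \<Delta>)"
      by (intro borel_measurable_lebesgue_on_Delta) measurable
  qed (use p in measurable)
  then obtain k where k: "mass p (\<lambda>s. F n s - G k s) \<le> ennreal \<eta>"
    using \<eta> by (rule ennreal_tendsto_0_le)
  have "mass p (\<lambda>s. f s - G k s) < ennreal \<epsilon>"
    using mass_diff_less[OF _ \<epsilon> f F G'] n k p unfolding \<eta>_def by simp
  moreover have "G k s = 0" if "real n + 1 \<le> norm s" for s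
    using that by (simp add: G_def cutoff_eq_0)
  ultimately show thesis
    using that[OF G G_bound] by blast
qed

section \<open>Strong continuity of translations\<close>

text \<open>For continuous \<open>h\<close> of compact support this is dominated convergence, which
  is why sequences are used. It passes to \<open>f\<close> because translations by points near
  \<open>t\<close> enlarge the mass of \<open>f - h\<close> by a uniformly bounded factor.\<close>

lemma mass_translate_continuous:
  fixes f :: "complex \<Rightarrow> 'k::euclidean_space"
  assumes p: "0 < p" and f: "f \<in> borel_measurable (lebesgue_on \<Delta>)" and fin: "mass p f < \<infinity>"
    and t: "t \<in> \<Delta>"
  shows "((\<lambda>s. mass p (\<lambda>u. f (u + s) - f (u + t))) \<longlongrightarrow> 0) (at t within \<Delta>)"
proof -
  have "\<forall>\<^sub>F n in sequentially. mass p (\<lambda>u. f (u + X n) - f (u + t)) < ennreal \<epsilon>"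
    if X: "\<And>n. X n \<in> \<Delta>" "X \<longlonglongrightarrow> t" and \<epsilon>: "0 < \<epsilon>" for X and \<epsilon> :: real
  proof -
    \<comment> \<open>Read backwards: within distance 1 of \<open>t\<close> the translation factor
      is at most \<open>exp (2 - 2 * Im t)\<close>, which turns \<open>\<eta>3\<close> into
      \<open>\<eta>2\<close>; \<open>\<eta>2\<close> and \<open>\<eta>1\<close> pay for two
      successive triangle inequalities.\<close>
    define \<eta>1 where "\<eta>1 = \<epsilon> / (4 * 2 powr p)"
    define \<eta>2 where "\<eta>2 = \<eta>1 / (4 * 2 powr p)"
    define \<eta>3 where "\<eta>3 = \<eta>2 * exp (2 * Im t - 2)"
    have \<eta>: "0 < \<eta>1" "0 < \<eta>2" "0 < \<eta>3"
      using \<epsilon> by (auto simp: \<eta>1_def \<eta>2_def \<eta>3_def)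
    obtain h B R where h: "continuous_on UNIV h" "\<And>s. norm (h s) \<le> B" "\<And>s. R \<le> norm s \<Longrightarrow> h s = 0"
      and fh: "mass p (\<lambda>s. f s - h s) < ennreal \<eta>3"
      using compactly_supported_continuous_dense[OF p \<eta>(3) f fin] by metis
    have h_shift: "(\<lambda>u. h (u + s)) \<in> borel_measurable (lebesgue_on \<Delta>)" for s
      by (intro borel_measurable_lebesgue_on_Delta borel_measurable_continuous_onI
          continuous_on_compose2[OF h(1)] continuous_intros) auto
    have h_meas: "h \<in> borel_measurable (lebesgue_on \<Delta>)"
      using h_shift[of 0] by simp
    have f_shift: "(\<lambda>u. f (u + s)) \<in> borel_measurable (lebesgue_on \<Delta>)" if "s \<in> \<Delta>" for s
      using borel_measurable_translate_Delta[OF f that] .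
    have close: "mass p (\<lambda>u. f (u + s) - h (u + s)) \<le> ennreal \<eta>2" if s: "s \<in> \<Delta>" "dist s t < 1" for s
    proof -
      have "\<bar>Im (s - t)\<bar> < 1"
        using s(2) abs_Im_le_cmod[of "s - t"] by (simp add: dist_norm)
      then have "exp (- 2 * Im s) \<le> exp (2 - 2 * Im t)"
        by simp
      then have "exp (- 2 * Im s) * \<eta>3 \<le> exp (2 - 2 * Im t) * \<eta>3"
        using \<eta>(3) by (intro mult_right_mono) auto
      also have "\<dots> = \<eta>2"
        by (simp add: \<eta>3_def exp_diff)
      finally have le: "exp (- 2 * Im s) * \<eta>3 \<le> \<eta>2" .
      have "mass p (\<lambda>u. f (u + s) - h (u + s))
          \<le> ennreal (exp (- 2 * Im s)) * mass p (\<lambda>u. f u - h u)"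
        using f h_meas s p by (intro mass_translate_Delta_le[where f = "\<lambda>u. f u - h u"]) auto
      also have "\<dots> \<le> ennreal (exp (- 2 * Im s)) * ennreal \<eta>3"
        using fh by (intro mult_left_mono) auto
      also have "\<dots> = ennreal (exp (- 2 * Im s) * \<eta>3)"
        by (simp add: ennreal_mult')
      also have "\<dots> \<le> ennreal \<eta>2"
        using le by (rule ennreal_leI)
      finally show ?thesis .
    qed
    have "(\<lambda>n. mass p (\<lambda>u. h (u + t) - h (u + X n))) \<longlonglongrightarrow> 0"
    proof (rule mass_dominated_convergence[where b = "\<lambda>u. if Re u < R then 2 * B else 0"])
      have "isCont h (u + t)" for u
        using h(1) by (simp add: continuous_on_eq_continuous_at)
      then show "AE u in lebesgue_on \<Delta>. (\<lambda>n. h (u + X n)) \<longlonglongrightarrow> h (u + t)"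
        using X(2) by (intro AE_I2 isCont_tendsto_compose[of _ h] tendsto_intros)
      \<comment> \<open>Adding a point of the sector does not decrease the real part, so all
        translates of \<open>h\<close> vanish beyond the same vertical line and one majorant serves
        every \<open>n\<close>.\<close>
      have "h (u + s) = 0" if "u \<in> \<Delta>" "s \<in> \<Delta>" "R \<le> Re u" for u s
        using that complex_Re_le_cmod[of "u + s"] by (intro h(3)) (auto simp: mem_Delta_iff)
      then show "norm (h (u + t) - h (u + X n)) \<le> (if Re u < R then 2 * B else 0)"
        if "u \<in> \<Delta>" for n u
        using that X(1)[of n] t norm_triangle_ineq4[of "h (u + t)" "h (u + X n)"]
          h(2)[of "u + t"] h(2)[of "u + X n"] by auto
      have "0 \<le> B"
        using h(2)[of 0] norm_ge_zero order_trans by blast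
      then show "mass p (\<lambda>u. if Re u < R then 2 * B else 0) < \<infinity>"
        by (intro mass_bounded_finite[OF p, where R = R and B = "2 * B"]) auto
      show "(\<lambda>u. if Re u < R then 2 * B else 0) \<in> borel_measurable (lebesgue_on \<Delta>)"
        by (intro borel_measurable_lebesgue_on_Delta) measurable
    qed (use p h_shift in auto)
    then have "\<forall>\<^sub>F n in sequentially. mass p (\<lambda>u. h (u + t) - h (u + X n)) < ennreal \<eta>2"
      using \<eta>(2) by (intro order_tendstoD(2)) auto
    moreover have "\<forall>\<^sub>F n in sequentially. dist (X n) t < 1"
      using X(2) by (simp add: tendsto_iff)
    ultimately show ?thesis
    proof eventually_elim
      case (elim n)
      have 1: "mass p (\<lambda>u. f (u + X n) - h (u + X n)) \<le> ennreal \<eta>2"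
        using close X(1) elim(2) by blast
      have 2: "mass p (\<lambda>u. h (u + X n) - h (u + t)) \<le> ennreal \<eta>2"
        using elim(1) mass_minus_commute[of p "\<lambda>u. h (u + X n)" "\<lambda>u. h (u + t)"] by simp
      have 3: "mass p (\<lambda>u. h (u + t) - f (u + t)) \<le> ennreal \<eta>2"
        using close[OF t] mass_minus_commute[of p "\<lambda>u. h (u + t)" "\<lambda>u. f (u + t)"] by simp
      have "mass p (\<lambda>u. f (u + X n) - h (u + t)) < ennreal \<eta>1"
        using p 1 2 unfolding \<eta>2_def
        by (intro mass_diff_less[OF _ \<eta>(1) f_shift[OF X(1)] h_shift[of "X n"] h_shift]) auto
      moreover have "ennreal \<eta>2 \<le> ennreal \<eta>1"
        using \<eta>(1) ge_one_powr_ge_zero[of 2 p] p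
        unfolding \<eta>2_def by (intro ennreal_leI) (simp add: field_simps)
      ultimately show ?case
        using p 3 \<eta>1_def
        by (intro mass_diff_less[OF _ \<epsilon> f_shift[OF X(1)] h_shift[of t] f_shift[OF t]]) auto
    qed
  qed
  then show ?thesis
    unfolding tendsto_at_iff_sequentially comp_def
    by (intro allI impI ennreal_tendsto_0I) auto
qed

section \<open>A countable dense family of step functions\<close>

text \<open>A step function on the square grid of mesh \<open>1 / Suc n\<close>, encoded by a finite
  list of cell indices with values and by 0 on unlisted cells. With values from a countable set
  there are only countably many such lists.\<close>

definition step :: "nat \<Rightarrow> ((int \<times> int) \<times> 'k::zero) list \<Rightarrow> complex \<Rightarrow> 'k" where
  "step n l s =
     (case map_of l (\<lfloor>real (Suc n) * Re s\<rfloor>, \<lfloor>real (Suc n) * Im s\<rfloor>) of None \<Rightarrow> 0 | Some q \<Rightarrow> q)"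

text \<open>The function factors through the cell index, which lives in a countable discrete space
  on which every map is measurable.\<close>

lemma borel_measurable_step:
  "step n l \<in> borel_measurable (lebesgue_on \<Delta>)"
proof (rule borel_measurable_lebesgue_on_Delta)
  have [measurable]: "(\<lambda>s. \<lfloor>real (Suc n) * Re s\<rfloor>) \<in> borel \<rightarrow>\<^sub>M count_space UNIV"
    "(\<lambda>s. \<lfloor>real (Suc n) * Im s\<rfloor>) \<in> borel \<rightarrow>\<^sub>M count_space UNIV"
    by (intro measurable_compose[OF _ measurable_real_floor] borel_measurable_continuous_onI
        continuous_intros)+
  have "(\<lambda>s. (\<lfloor>real (Suc n) * Re s\<rfloor>, \<lfloor>real (Suc n) * Im s\<rfloor>)) \<in> borel \<rightarrow>\<^sub>M count_space UNIV"
    by (subst pair_measure_countable[of UNIV UNIV, simplified, symmetric]) measurable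
  then show "step n l \<in> borel_measurable borel"
    unfolding step_def[abs_def]
    by (rule measurable_compose[where g = "\<lambda>ij. case map_of l ij of None \<Rightarrow> 0 | Some q \<Rightarrow> q"]) simp
qed

lemma step_nonzeroD:
  assumes "step n l s \<noteq> 0"
  shows "(\<lfloor>real (Suc n) * Re s\<rfloor>, \<lfloor>real (Suc n) * Im s\<rfloor>) \<in> fst ` set l" "step n l s \<in> snd ` set l"
proof -
  obtain q where "map_of l (\<lfloor>real (Suc n) * Re s\<rfloor>, \<lfloor>real (Suc n) * Im s\<rfloor>) = Some q" "step n l s = q"
    using assms by (auto simp: step_def split: option.splits)
  then show "(\<lfloor>real (Suc n) * Re s\<rfloor>, \<lfloor>real (Suc n) * Im s\<rfloor>) \<in> fst ` set l"
    "step n l s \<in> snd ` set l"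
    by (force dest: map_of_SomeD)+
qed

lemma step_bounded:
  fixes l :: "((int \<times> int) \<times> 'k::real_normed_vector) list"
  obtains B where "\<And>s. norm (step n l s) \<le> B"
proof -
  have "bounded (insert 0 (snd ` set l))"
    by (rule finite_imp_bounded) simp
  then obtain B where "\<forall>z\<in>insert 0 (snd ` set l). norm z \<le> B"
    unfolding bounded_iff by (rule exE)
  then have "norm (step n l s) \<le> B" for s
    using step_nonzeroD(2)[of n l s] by (cases "step n l s = 0") auto
  then show thesis by (rule that)
qed

lemma step_support:
  obtains R where "0 \<le> R" "\<And>s. R \<le> Re s \<Longrightarrow> step n l s = 0"
proof -
  have "finite (fst ` fst ` set l)" by simp
  then obtain K where K: "\<And>i. i \<in> fst ` fst ` set l \<Longrightarrow> i \<le> K"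
    by (meson Max.coboundedI)
  \<comment> \<open>The index bound \<open>K\<close> may be negative, hence the absolute value; the
    added 1 makes up for the floor.\<close>
  have "step n l s = 0" if "real_of_int (\<bar>K\<bar> + 1) \<le> Re s" for s
  proof (rule ccontr)
    assume "step n l s \<noteq> 0"
    from step_nonzeroD(1)[OF this] have "\<lfloor>real (Suc n) * Re s\<rfloor> \<le> \<bar>K\<bar>"
      using K by force
    then have "real (Suc n) * Re s < real_of_int \<bar>K\<bar> + 1"
      by linarith
    moreover have "Re s \<le> real (Suc n) * Re s"
      using that by (simp add: mult_le_cancel_right1)
    ultimately show False
      using that by linarith
  qed
  then show thesis
    by (intro that[of "real_of_int (\<bar>K\<bar> + 1)"]) auto
qed

text \<open>The lower left corner of the cell containing \<open>s\<close>, used as its sampling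
  point.\<close>

definition grid :: "nat \<Rightarrow> complex \<Rightarrow> complex" where
  "grid n s = Complex (real_of_int \<lfloor>real (Suc n) * Re s\<rfloor> / real (Suc n))
     (real_of_int \<lfloor>real (Suc n) * Im s\<rfloor> / real (Suc n))"

lemma floor_div_bounds:
  assumes "0 < (n::real)"
  shows "x - 1 / n \<le> real_of_int \<lfloor>n * x\<rfloor> / n" "real_of_int \<lfloor>n * x\<rfloor> / n \<le> x"
proof -
  have "(n * x - 1) / n \<le> real_of_int \<lfloor>n * x\<rfloor> / n" "real_of_int \<lfloor>n * x\<rfloor> / n \<le> n * x / n"
    using assms by (intro divide_right_mono; linarith)+
  then show "x - 1 / n \<le> real_of_int \<lfloor>n * x\<rfloor> / n" "real_of_int \<lfloor>n * x\<rfloor> / n \<le> x"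
    using assms by (simp_all add: diff_divide_distrib)
qed

lemma grid_tendsto: "(\<lambda>n. grid n s) \<longlonglongrightarrow> s"
proof -
  have *: "(\<lambda>n. real_of_int \<lfloor>real (Suc n) * x\<rfloor> / real (Suc n)) \<longlonglongrightarrow> x" for x
  proof (rule tendsto_sandwich)
    have "(\<lambda>n. x - 1 / real (Suc n)) \<longlonglongrightarrow> x - 0"
      using LIMSEQ_inverse_real_of_nat by (intro tendsto_intros) (simp add: inverse_eq_divide)
    then show "(\<lambda>n. x - 1 / real (Suc n)) \<longlonglongrightarrow> x" by simp
    show "\<forall>\<^sub>F n in sequentially. x - 1 / real (Suc n) \<le> real_of_int \<lfloor>real (Suc n) * x\<rfloor> / real (Suc n)"
      by (intro always_eventually allI floor_div_bounds) simp
    show "\<forall>\<^sub>F n in sequentially. real_of_int \<lfloor>real (Suc n) * x\<rfloor> / real (Suc n) \<le> x"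
      by (intro always_eventually allI floor_div_bounds) simp
  qed simp
  show ?thesis
    using tendsto_Complex[OF *[of "Re s"] *[of "Im s"]] by (simp add: grid_def)
qed

text \<open>\<open>h\<close> is sampled at cell corners and each sample is rounded into
  \<open>insert 0 Q\<close>. Continuity and shrinking mesh give pointwise convergence; boundedness
  and bounded support give the majorant.\<close>

lemma step_dense_in_continuous:
  fixes h :: "complex \<Rightarrow> 'k::euclidean_space"
  assumes p: "0 < p" and \<epsilon>: "0 < (\<epsilon>::real)"
    and h: "continuous_on UNIV h" "\<And>s. norm (h s) \<le> B" "\<And>s. R \<le> norm s \<Longrightarrow> h s = 0"
    and Q: "\<And>U. open U \<Longrightarrow> U \<noteq> {} \<Longrightarrow> \<exists>q\<in>Q. q \<in> U"
  obtains n l where "set l \<subseteq> UNIV \<times> insert 0 Q" "mass p (\<lambda>s. h s - step n l s) \<le> ennreal \<epsilon>"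
proof -
  \<comment> \<open>Rounding must send 0 to exactly 0, or the step function would not vanish where
    \<open>h\<close> does. Since 0 may be missing from \<open>Q\<close>, it is inserted.\<close>
  have *: "\<exists>q. q \<in> insert 0 Q \<and> dist q z < 1 / real (Suc n) \<and> (z = 0 \<longrightarrow> q = 0)" for n z
  proof (cases "z = 0")
    case False
    have "ball z (1 / real (Suc n)) \<noteq> {}"
      by (simp del: of_nat_Suc)
    then show ?thesis
      using Q[of "ball z (1 / real (Suc n))"] False by (auto simp: dist_commute)
  qed auto
  have "\<exists>\<phi>. \<forall>n z. \<phi> n z \<in> insert 0 Q \<and> dist (\<phi> n z) z < 1 / real (Suc n) \<and> (z = 0 \<longrightarrow> \<phi> n z = 0)"
    by (intro choice allI *)
  then obtain \<phi> where "\<forall>n z. \<phi> n z \<in> insert 0 Q \<and> dist (\<phi> n z) z < 1 / real (Suc n) \<and> (z = 0 \<longrightarrow> \<phi> n z = 0)"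
    ..
  then have \<phi>: "\<phi> n z \<in> insert 0 Q" "dist (\<phi> n z) z < 1 / real (Suc n)" "\<phi> n 0 = 0" for n z
    by blast+
  \<comment> \<open>An index beyond \<open>K n\<close> in either coordinate puts the corner at
    distance at least \<open>R\<close> from the origin, where \<open>h\<close> vanishes. The finite
    list of remaining cells thus describes the sampled function everywhere.\<close>
  define K where "K n = \<lceil>\<bar>R\<bar> * real (Suc n)\<rceil>" for n
  define c where "c n ij = \<phi> n (h (Complex (real_of_int (fst ij) / real (Suc n))
      (real_of_int (snd ij) / real (Suc n))))" for n ij
  define l where "l n = map (\<lambda>ij. (ij, c n ij)) (List.product [- K n..K n] [- K n..K n])" for n
  have step_l: "step n (l n) s = \<phi> n (h (grid n s))" for n s
  proof -
    let ?i = "\<lfloor>real (Suc n) * Re s\<rfloor>" and ?j = "\<lfloor>real (Suc n) * Im s\<rfloor>"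
    have "c n (?i, ?j) = 0" if "\<not> (- K n \<le> ?i \<and> ?i \<le> K n \<and> - K n \<le> ?j \<and> ?j \<le> K n)"
    proof -
      have "\<bar>R\<bar> * real (Suc n) \<le> real_of_int (K n)"
        unfolding K_def by linarith
      moreover have "real_of_int (K n) \<le> \<bar>real_of_int ?i\<bar> \<or> real_of_int (K n) \<le> \<bar>real_of_int ?j\<bar>"
        using that by linarith
      ultimately have "\<bar>R\<bar> \<le> \<bar>real_of_int ?i\<bar> / real (Suc n) \<or> \<bar>R\<bar> \<le> \<bar>real_of_int ?j\<bar> / real (Suc n)"
        by (simp add: pos_le_divide_eq del: of_nat_Suc) linarith
      then have "\<bar>R\<bar> \<le> \<bar>Re (grid n s)\<bar> \<or> \<bar>R\<bar> \<le> \<bar>Im (grid n s)\<bar>"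
        by (simp add: grid_def del: of_nat_Suc)
      then have "R \<le> norm (grid n s)"
        using abs_Re_le_cmod[of "grid n s"] abs_Im_le_cmod[of "grid n s"] by linarith
      then show ?thesis
        using h(3)[of "grid n s"] \<phi>(3) by (simp add: c_def grid_def)
    qed
    then have "step n (l n) s = c n (?i, ?j)"
      unfolding step_def l_def map_of_map_restrict
      by (auto simp: restrict_map_def split: option.splits)
    then show ?thesis
      by (simp add: c_def grid_def)
  qed
  have "(\<lambda>n. mass p (\<lambda>s. h s - step n (l n) s)) \<longlonglongrightarrow> 0"
  \<comment> \<open>A corner lies at most 1 to the left of \<open>s\<close>, hence
    \<open>R + 1\<close>. The bound collects \<open>B\<close> for \<open>h s\<close>,
    \<open>B\<close> for the sample and 1 for the rounding error.\<close>
  proof (rule mass_dominated_convergence[where b = "\<lambda>s. if Re s < R + 1 then 2 * B + 1 else 0"])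
    show "AE s in lebesgue_on \<Delta>. (\<lambda>n. step n (l n) s) \<longlonglongrightarrow> h s"
    proof (rule AE_I2)
      fix s
      have "isCont h s"
        using h(1) by (simp add: continuous_on_eq_continuous_at)
      then have *: "(\<lambda>n. h (grid n s)) \<longlonglongrightarrow> h s"
        using grid_tendsto by (rule isCont_tendsto_compose)
      have "(\<lambda>n. \<phi> n (h (grid n s)) - h (grid n s)) \<longlonglongrightarrow> 0"
      proof (rule Lim_null_comparison)
        show "(\<lambda>n. 1 / real (Suc n)) \<longlonglongrightarrow> 0"
          using LIMSEQ_inverse_real_of_nat by (simp add: inverse_eq_divide)
        show "\<forall>\<^sub>F n in sequentially. norm (\<phi> n (h (grid n s)) - h (grid n s)) \<le> 1 / real (Suc n)"
          using \<phi>(2) by (intro always_eventually allI less_imp_le) (simp add: dist_norm)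
      qed
      from tendsto_add[OF this *] show "(\<lambda>n. step n (l n) s) \<longlonglongrightarrow> h s"
        by (simp add: step_l)
    qed
    show "norm (h s - step n (l n) s) \<le> (if Re s < R + 1 then 2 * B + 1 else 0)" for n s
    proof (cases "Re s < R + 1")
      case True
      have "norm (h s - step n (l n) s)
          \<le> norm (h s) + norm (h (grid n s)) + dist (\<phi> n (h (grid n s))) (h (grid n s))"
        unfolding step_l dist_norm by norm
      also have "\<dots> \<le> B + B + 1"
        using \<phi>(2)[of n "h (grid n s)"]
        by (intro add_mono h(2)) (smt (verit) divide_le_eq_1 of_nat_0_le_iff of_nat_Suc)
      finally show ?thesis using True by simp
    next
      case False
      have "1 / real (Suc n) \<le> 1" by simp
      moreover have "Re s - 1 / real (Suc n) \<le> Re (grid n s)"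
        unfolding grid_def complex.sel by (rule floor_div_bounds) simp
      ultimately have "R \<le> Re (grid n s)"
        using False by linarith
      then have "R \<le> norm (grid n s)" "R \<le> norm s"
        using complex_Re_le_cmod[of s] complex_Re_le_cmod[of "grid n s"] False by linarith+
      then show ?thesis
        using False h(3) \<phi>(3) by (simp add: step_l)
    qed
    have "0 \<le> B"
      using h(2)[of 0] norm_ge_zero order_trans by blast
    then show "mass p (\<lambda>s. if Re s < R + 1 then 2 * B + 1 else 0) < \<infinity>"
      by (intro mass_bounded_finite[OF p, where R = "R + 1" and B = "2 * B + 1"]) auto
    show "(\<lambda>s. if Re s < R + 1 then 2 * B + 1 else 0) \<in> borel_measurable (lebesgue_on \<Delta>)"
      by (intro borel_measurable_lebesgue_on_Delta) measurable
    show "h \<in> borel_measurable (lebesgue_on \<Delta>)"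
      using h(1) by (intro borel_measurable_lebesgue_on_Delta borel_measurable_continuous_onI)
  qed (use p borel_measurable_step in auto)
  then obtain n where n: "mass p (\<lambda>s. h s - step n (l n) s) \<le> ennreal \<epsilon>"
    using \<epsilon> by (rule ennreal_tendsto_0_le)
  moreover have "set (l n) \<subseteq> UNIV \<times> insert 0 Q"
    using \<phi>(1) by (auto simp: l_def c_def)
  ultimately show thesis
    using that by blast
qed

text \<open>Enumerability serves the dense orbit; support bounded on the right serves every gluing.
  Approximation passes from \<open>f\<close> through a compactly supported continuous function to a
  step function.\<close>

lemma countable_dense_family:
  assumes p: "0 < p"
  obtains d :: "nat \<Rightarrow> complex \<Rightarrow> 'k::euclidean_space"
  where "\<forall>n. d n \<in> borel_measurable (lebesgue_on \<Delta>)"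
    and "\<forall>n. \<exists>R\<ge>0. \<forall>s. R \<le> Re s \<longrightarrow> d n s = 0"
    and "\<forall>n. mass p (d n) < \<infinity>"
    and "\<forall>f\<in>borel_measurable (lebesgue_on \<Delta>). mass p f < \<infinity> \<longrightarrow>
      (\<forall>\<epsilon>>0. \<exists>n. mass p (\<lambda>s. f s - d n s) < ennreal \<epsilon>)"
proof -
  obtain Q :: "'k set" where Q: "countable Q" "\<And>U. open U \<Longrightarrow> U \<noteq> {} \<Longrightarrow> \<exists>q\<in>Q. q \<in> U"
    using countable_dense_setE[where ?'a = 'k] by metis
  let ?I = "(UNIV :: nat set) \<times> lists ((UNIV :: (int \<times> int) set) \<times> insert 0 Q)"
  have I: "countable ?I" "?I \<noteq> {}"
    using Q(1) by (auto intro!: countable_SIGMA countable_lists countableI_type)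
  define d where "d n = case_prod step (from_nat_into ?I n)" for n
  have d: "\<exists>m l. d n = step m l" for n
    unfolding d_def by (simp add: case_prod_beta) blast
  show thesis
  proof (rule that; intro allI ballI impI)
    show "d n \<in> borel_measurable (lebesgue_on \<Delta>)" for n
      using d[of n] borel_measurable_step by metis
    show "\<exists>R\<ge>0. \<forall>s. R \<le> Re s \<longrightarrow> d n s = 0" for n
      using d[of n] step_support by metis
    show "mass p (d n) < \<infinity>" for n
    proof -
      obtain m l where ml: "d n = step m l" using d by blast
      obtain B where "\<And>s. norm (step m l s) \<le> B"
        using step_bounded by metis
      moreover obtain R where "\<And>s. R \<le> Re s \<Longrightarrow> step m l s = 0"
        using step_support by metis
      ultimately show ?thesis
        unfolding ml by (intro mass_bounded_finite[OF p]) auto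
    qed
    fix f :: "complex \<Rightarrow> 'k" and \<epsilon> :: real
    assume f: "f \<in> borel_measurable (lebesgue_on \<Delta>)" "mass p f < \<infinity>" and \<epsilon>: "0 < \<epsilon>"
    define \<eta> where "\<eta> = \<epsilon> / (4 * 2 powr p)"
    have \<eta>: "0 < \<eta>" using \<epsilon> by (simp add: \<eta>_def)
    obtain h B R where h: "continuous_on UNIV h" "\<And>s. norm (h s) \<le> B" "\<And>s. R \<le> norm s \<Longrightarrow> h s = 0"
      and fh: "mass p (\<lambda>s. f s - h s) < ennreal \<eta>"
      using compactly_supported_continuous_dense[OF p \<eta> f] by metis
    obtain m l where l: "set l \<subseteq> UNIV \<times> insert 0 Q"
      and hl: "mass p (\<lambda>s. h s - step m l s) \<le> ennreal \<eta>"
      using step_dense_in_continuous[OF p \<eta> h Q(2)] by metis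
    from l have "(m, l) \<in> ?I" by auto
    then obtain n where n: "from_nat_into ?I n = (m, l)"
      using from_nat_into_surj[OF I(1)] by blast
    have "mass p (\<lambda>s. f s - d n s) < ennreal \<epsilon>"
      unfolding d_def n prod.case
      using p fh hl h(1) f unfolding \<eta>_def
      by (intro mass_diff_less[OF _ \<epsilon> _ _ borel_measurable_step, of _ _ h])
        (auto intro: borel_measurable_lebesgue_on_Delta borel_measurable_continuous_onI)
    then show "\<exists>n. mass p (\<lambda>s. f s - d n s) < ennreal \<epsilon>" ..
  qed
qed

section \<open>Gluing along the lower boundary ray\<close>

text \<open>The point \<open>x * (1 - i)\<close>, parametrised by its real part, so that one number
  measures both the horizontal displacement and the gain \<open>exp (- 2 * x)\<close> of a copy
  moved inward.\<close>

definition ray :: "real \<Rightarrow> complex" where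
  "ray x = Complex x (- x)"

lemma ray_simps [simp]: "Re (ray x) = x" "Im (ray x) = - x"
  by (simp_all add: ray_def)

lemma ray_in_Delta: "0 \<le> x \<Longrightarrow> ray x \<in> \<Delta>"
  by (simp add: mem_Delta_iff)

text \<open>The spacing condition puts copy \<open>n\<close> into the strip from \<open>a n\<close>
  to \<open>a n + R n\<close>, and these strips are disjoint. No summability of masses is assumed:
  the pointwise sum has at most one nonzero term, and the mass estimate may have an infinite
  right-hand side.\<close>

locale gluing =
  fixes p :: real and g :: "nat \<Rightarrow> complex \<Rightarrow> 'k::euclidean_space" and a R :: "nat \<Rightarrow> real"
  assumes p: "0 < p"
    and meas: "g n \<in> borel_measurable (lebesgue_on \<Delta>)"
    and off: "s \<notin> \<Delta> \<Longrightarrow> g n s = 0"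
    and supp: "R n \<le> Re s \<Longrightarrow> g n s = 0"
    and R: "0 \<le> R n"
    and a0: "a 0 = 0"
    and a_Suc: "a n + R n \<le> a (Suc n)"
begin

definition glued :: "complex \<Rightarrow> 'k" where
  "glued s = (\<Sum>n. g n (s - ray (a n)))"

lemma a_mono:
  assumes "m \<le> n"
  shows "a m \<le> a n"
proof -
  have "a n \<le> a (Suc n)" for n
    using a_Suc[of n] R[of n] by linarith
  then show ?thesis
    using assms by (rule lift_Suc_mono_le)
qed

lemma a_less: "m < n \<Longrightarrow> a m + R m \<le> a n"
  using a_mono[of "Suc m" n] a_Suc[of m] by simp

lemma Re_bounds:
  assumes "g n (s - ray (a n)) \<noteq> 0"
  shows "a n \<le> Re s" "Re s < a n + R n"
proof -
  have "s - ray (a n) \<in> \<Delta>"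
    using off assms by blast
  then show "a n \<le> Re s"
    by (auto simp: mem_Delta_iff)
  have "\<not> R n \<le> Re (s - ray (a n))"
    using supp assms by blast
  then show "Re s < a n + R n"
    by simp
qed

lemma terms_disjoint:
  assumes "g n (s - ray (a n)) \<noteq> 0" "m \<noteq> n"
  shows "g m (s - ray (a m)) = 0"
proof (rule ccontr)
  assume "g m (s - ray (a m)) \<noteq> 0"
  from Re_bounds[OF this] Re_bounds[OF assms(1)] a_less[of m n] a_less[of n m] assms(2)
  show False by (cases "m < n") auto
qed

lemma finite_terms: "finite {n. g n (s - ray (a n)) \<noteq> 0}"
proof (cases "\<exists>n. g n (s - ray (a n)) \<noteq> 0")
  case True
  then obtain n where "g n (s - ray (a n)) \<noteq> 0" by blast
  then have "{n. g n (s - ray (a n)) \<noteq> 0} \<subseteq> {n}"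
    using terms_disjoint by blast
  then show ?thesis
    using finite_subset by blast
qed simp

lemma summable_terms: "summable (\<lambda>n. g n (s - ray (a n)))"
  using finite_terms by (rule summable_finite) simp

lemma glued_eq:
  assumes "g n (s - ray (a n)) \<noteq> 0"
  shows "glued s = g n (s - ray (a n))"
  unfolding glued_def using suminf_finite[of "{n}" "\<lambda>n. g n (s - ray (a n))"] terms_disjoint[OF assms] by simp

lemma borel_measurable_glued: "glued \<in> borel_measurable (lebesgue_on \<Delta>)"
proof -
  have "(\<lambda>s. g n (s + - ray (a n))) \<in> borel_measurable (lebesgue_on \<Delta>)" for n
    using meas off by (rule borel_measurable_translate)
  then show ?thesis
    unfolding glued_def[abs_def] by (intro borel_measurable_suminf) simp
qed

text \<open>The point \<open>s + ray (a m)\<close> lies to the right of all strips with index below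
  \<open>m\<close>, so besides \<open>g m s\<close> only later copies contribute. As at most one
  term is nonzero, the power of the sum is bounded by the sum of the powers without a
  constant.\<close>

lemma glued_diff_le:
  assumes s: "s \<in> \<Delta>"
  shows "ennreal (norm (glued (s + ray (a m)) - g m s) powr p) \<le>
    (\<Sum>k. ennreal (norm (g (m + 1 + k) (s + (ray (a m) - ray (a (m + 1 + k))))) powr p))"
    (is "_ \<le> ?S")
proof (cases "glued (s + ray (a m)) = g m s")
  case False
  have "\<exists>n. g n (s + ray (a m) - ray (a n)) \<noteq> 0"
  proof (rule ccontr)
    assume zero: "\<nexists>n. g n (s + ray (a m) - ray (a n)) \<noteq> 0"
    then have "glued (s + ray (a m)) = 0"
      unfolding glued_def by simp
    moreover have "g m s = 0"
      using zero by (metis add_diff_cancel_right')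
    ultimately show False
      using False by simp
  qed
  then obtain n where n: "g n (s + ray (a m) - ray (a n)) \<noteq> 0" by blast
  then have eq: "glued (s + ray (a m)) = g n (s + ray (a m) - ray (a n))"
    by (rule glued_eq)
  with False have "n \<noteq> m" by auto
  moreover have "\<not> n < m"
    using Re_bounds(2)[OF n] a_less[of n m] s by (auto simp: mem_Delta_iff)
  ultimately have "m < n" by simp
  have "g m s = 0"
    using terms_disjoint[OF n, of m] \<open>n \<noteq> m\<close> by simp
  obtain k where k: "n = m + 1 + k"
    using \<open>m < n\<close> less_iff_Suc_add by auto
  have "ennreal (norm (glued (s + ray (a m)) - g m s) powr p)
      = (\<Sum>i\<in>{k}. ennreal (norm (g (m + 1 + i) (s + (ray (a m) - ray (a (m + 1 + i))))) powr p))"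
    using \<open>g m s = 0\<close> by (simp add: eq k add_diff_eq)
  also have "\<dots> \<le> ?S"
    by (intro sum_le_suminf) auto
  finally show ?thesis .
qed (use p in simp)

text \<open>Relative to copy \<open>m\<close>, a later copy is evaluated at an offset whose
  imaginary part is \<open>a (m + 1 + k) - a m\<close>; translation by this offset yields the
  exponential gain.\<close>

lemma mass_glued_le:
  "mass p (\<lambda>s. glued (s + ray (a m)) - g m s) \<le>
    (\<Sum>k. ennreal (exp (- 2 * (a (m + 1 + k) - a m))) * mass p (g (m + 1 + k)))"
proof -
  let ?w = "\<lambda>k. ray (a m) - ray (a (m + 1 + k))"
  have [measurable]: "(\<lambda>s. g n (s + w)) \<in> borel_measurable (lebesgue_on \<Delta>)" for n w
    using meas off by (rule borel_measurable_translate)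
  have "mass p (\<lambda>s. glued (s + ray (a m)) - g m s) \<le>
      (\<integral>\<^sup>+ s. (\<Sum>k. ennreal (norm (g (m + 1 + k) (s + ?w k)) powr p * exp (2 * Im s)))
        \<partial>lebesgue_on \<Delta>)"
    unfolding mass_def
  proof (rule nn_integral_mono)
    fix s assume "s \<in> space (lebesgue_on \<Delta>)"
    then have "ennreal (norm (glued (s + ray (a m)) - g m s) powr p) * ennreal (exp (2 * Im s)) \<le>
      (\<Sum>k. ennreal (norm (g (m + 1 + k) (s + ?w k)) powr p)) * ennreal (exp (2 * Im s))"
      by (intro mult_right_mono glued_diff_le) auto
    then show "ennreal (norm (glued (s + ray (a m)) - g m s) powr p * exp (2 * Im s)) \<le>
      (\<Sum>k. ennreal (norm (g (m + 1 + k) (s + ?w k)) powr p * exp (2 * Im s)))"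
      by (simp add: ennreal_mult'' ennreal_suminf_multc)
  qed
  also have "\<dots> = (\<Sum>k. mass p (\<lambda>s. g (m + 1 + k) (s + ?w k)))"
    unfolding mass_def by (intro nn_integral_suminf) measurable
  also have "\<dots> \<le> (\<Sum>k. ennreal (exp (- 2 * Im (?w k))) * mass p (g (m + 1 + k)))"
    using meas off p by (intro suminf_le mass_translate_le) auto
  finally show ?thesis
    by simp
qed

text \<open>The shift carries copy \<open>n + 1\<close> to the place of copy \<open>n\<close>, while
  copy 0 disappears because its argument has real part at least \<open>c\<close>, and
  \<open>a_Suc\<close> at 0 says that \<open>c\<close> exceeds or equals its support bound.\<close>

lemma glued_periodic:
  assumes g: "\<And>n. g n = h" and a: "\<And>n. a n = real n * c" and s: "s \<in> \<Delta>"
  shows "glued (s + ray c) = glued s"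
proof -
  let ?t = "\<lambda>n. g n (s + ray c - ray (a n))"
  have "?t (Suc n) = g n (s - ray (a n))" for n
    unfolding g by (rule arg_cong[of _ _ h]) (simp add: a complex_eq_iff algebra_simps)
  then have "glued s = (\<Sum>n. ?t (Suc n))"
    unfolding glued_def by simp
  also have "\<dots> = glued (s + ray c) - ?t 0"
    unfolding glued_def by (rule suminf_split_head) (rule summable_terms)
  also have "?t 0 = 0"
    using s a_Suc[of 0] by (intro supp) (auto simp: a mem_Delta_iff)
  finally show ?thesis by simp
qed

end

section \<open>The quotient space\<close>

abbreviation exp_weight :: "complex \<Rightarrow> real" where
  "exp_weight \<equiv> (\<lambda>s. exp (2 * Im s))"

definition Lp_class :: "real \<Rightarrow> (complex \<Rightarrow> 'k::real_normed_field) \<Rightarrow> (complex \<Rightarrow> 'k) set" where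
  "Lp_class p f = Lp_rel p exp_weight `` {f}"

text \<open>A weight prescribed only on the sector can be replaced by \<open>exp_weight\<close>;
  spaces and operators become literally equal, so results carry over by rewriting.\<close>

lemma Lp_weight_cong:
  assumes "\<And>s. s \<in> \<Delta> \<Longrightarrow> v s = w s"
  shows "Lp p v = (Lp p w :: ('k::real_normed_field, (complex \<Rightarrow> 'k) set) normed_space)"
    and "translation p v = (translation p w :: complex \<Rightarrow> (complex \<Rightarrow> 'k) set \<Rightarrow> (complex \<Rightarrow> 'k) set)"
proof -
  have "integrable (lebesgue_on \<Delta>) (\<lambda>t. norm (f t) powr p * v t)
      \<longleftrightarrow> integrable (lebesgue_on \<Delta>) (\<lambda>t. norm (f t) powr p * w t)" for f :: "complex \<Rightarrow> 'k"
    using assms by (intro Bochner_Integration.integrable_cong) auto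
  then have "Lp_functions p v = (Lp_functions p w :: (complex \<Rightarrow> 'k) set)"
    unfolding Lp_functions_def by simp
  then have rel: "Lp_rel p v = (Lp_rel p w :: ((complex \<Rightarrow> 'k) \<times> (complex \<Rightarrow> 'k)) set)"
    and funs: "Lp_functions p v = (Lp_functions p w :: (complex \<Rightarrow> 'k) set)"
    unfolding Lp_rel_def by simp_all
  have "Lp_fun_norm p v f = Lp_fun_norm p w f" for f :: "complex \<Rightarrow> 'k"
    unfolding Lp_fun_norm_def using assms
    by (intro arg_cong[where f = "\<lambda>x. x powr (1 / p)"] Bochner_Integration.integral_cong) auto
  then have norm: "Lp_fun_norm p v = (Lp_fun_norm p w :: (complex \<Rightarrow> 'k) \<Rightarrow> real)"
    by blast
  show "Lp p v = (Lp p w :: ('k, (complex \<Rightarrow> 'k) set) normed_space)"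
    unfolding Lp_def rel funs norm ..
  show "translation p v = (translation p w :: complex \<Rightarrow> (complex \<Rightarrow> 'k) set \<Rightarrow> (complex \<Rightarrow> 'k) set)"
    unfolding translation_def[abs_def] rel ..
qed

lemma mem_Lp_functions_iff:
  fixes f :: "complex \<Rightarrow> 'k::{real_normed_field, euclidean_space}"
  shows "f \<in> Lp_functions p exp_weight \<longleftrightarrow> f \<in> borel_measurable (lebesgue_on \<Delta>) \<and> mass p f < \<infinity>"
proof -
  have "(\<lambda>t. norm (f t) powr p * exp (2 * Im t)) \<in> borel_measurable (lebesgue_on \<Delta>)"
    if [measurable]: "f \<in> borel_measurable (lebesgue_on \<Delta>)"
    by measurable
  then show ?thesis
    unfolding Lp_functions_def mass_def by (auto simp: integrable_iff_bounded)
qed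

lemma Lp_fun_norm_eq:
  fixes f :: "complex \<Rightarrow> 'k::{real_normed_field, euclidean_space}"
  assumes [measurable]: "f \<in> borel_measurable (lebesgue_on \<Delta>)"
  shows "Lp_fun_norm p exp_weight f = enn2real (mass p f) powr (1 / p)"
  unfolding Lp_fun_norm_def mass_def by (subst integral_eq_nn_integral) auto

lemma mass_eq_0_iff:
  fixes f :: "complex \<Rightarrow> 'k::{second_countable_topology, real_normed_vector}"
  assumes [measurable]: "f \<in> borel_measurable (lebesgue_on \<Delta>)"
  shows "mass p f = 0 \<longleftrightarrow> (AE s in lebesgue_on \<Delta>. f s = 0)"
  unfolding mass_def by (subst nn_integral_0_iff_AE) (auto simp: ennreal_eq_0_iff mult_le_0_iff)

text \<open>Collapses the union that lifts an operation to classes once the choice of representative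
  is known not to matter.\<close>

lemma UN_constant_on:
  assumes "a \<in> A" "\<And>x. x \<in> A \<Longrightarrow> h x = h a"
  shows "(\<Union>x\<in>A. h x) = h a"
proof -
  have "(\<Union>x\<in>A. h x) = (\<Union>x\<in>A. h a)"
    by (rule SUP_cong[OF refl assms(2)])
  also have "\<dots> = h a"
    using assms(1) by blast
  finally show ?thesis .
qed

section \<open>Operations on classes expressed by representatives\<close>

context
  fixes p :: real
  assumes p: "0 < p"
begin

abbreviation "funs \<equiv> Lp_functions p exp_weight"
abbreviation "Lexp \<equiv> Lp p exp_weight"
abbreviation "shift \<equiv> translation p exp_weight"

lemma funs_add:
  fixes f g :: "complex \<Rightarrow> 'k::{real_normed_field, euclidean_space}"
  assumes "f \<in> funs" "g \<in> funs"
  shows "(\<lambda>s. f s + g s) \<in> funs"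
proof -
  have [measurable]: "f \<in> borel_measurable (lebesgue_on \<Delta>)" "g \<in> borel_measurable (lebesgue_on \<Delta>)"
    using assms by (simp_all add: mem_Lp_functions_iff)
  have "ennreal (2 powr p) * (mass p f + mass p g) < \<infinity>"
    using assms by (simp add: mem_Lp_functions_iff ennreal_mult_less_top)
  then have "mass p (\<lambda>s. f s + g s) < \<infinity>"
    using mass_add_le[of p f g] p by (simp add: order_le_less_trans)
  then show ?thesis
    by (simp add: mem_Lp_functions_iff)
qed

lemma funs_scale:
  fixes f :: "complex \<Rightarrow> 'k::{real_normed_field, euclidean_space}"
  assumes "f \<in> funs"
  shows "(\<lambda>s. c * f s) \<in> funs"
proof -
  have [measurable]: "f \<in> borel_measurable (lebesgue_on \<Delta>)"
    using assms by (simp add: mem_Lp_functions_iff)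
  have "(\<lambda>s. c * f s) \<in> borel_measurable (lebesgue_on \<Delta>)"
    by measurable
  then show ?thesis
    using assms by (simp add: mem_Lp_functions_iff mass_scale ennreal_mult_less_top)
qed

lemma funs_diff:
  fixes f g :: "complex \<Rightarrow> 'k::{real_normed_field, euclidean_space}"
  assumes "f \<in> funs" "g \<in> funs"
  shows "(\<lambda>s. f s - g s) \<in> funs"
  using funs_add[OF assms(1) funs_scale[OF assms(2), of "- 1"]] by simp

lemma funs_translate:
  fixes f :: "complex \<Rightarrow> 'k::{real_normed_field, euclidean_space}"
  assumes "f \<in> funs" "t \<in> \<Delta>"
  shows "(\<lambda>s. f (s + t)) \<in> funs"
proof -
  have f: "f \<in> borel_measurable (lebesgue_on \<Delta>)" "mass p f < \<infinity>"
    using assms by (simp_all add: mem_Lp_functions_iff)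
  then have "ennreal (exp (- 2 * Im t)) * mass p f < \<infinity>"
    by (simp add: ennreal_mult_less_top)
  then show ?thesis
    using mass_translate_Delta_le[OF f(1) assms(2) p] borel_measurable_translate_Delta[OF f(1) assms(2)]
    by (simp add: mem_Lp_functions_iff order_le_less_trans)
qed

lemma mem_Lp_class_iff:
  "g \<in> Lp_class p f \<longleftrightarrow> f \<in> funs \<and> g \<in> funs \<and> (AE s in lebesgue_on \<Delta>. f s = g s)"
  by (auto simp: Lp_class_def Lp_rel_def)

lemma Lp_class_self: "f \<in> funs \<Longrightarrow> f \<in> Lp_class p f"
  by (simp add: mem_Lp_class_iff)

lemma Lp_class_eqI:
  assumes "f \<in> funs" "g \<in> funs" and eq: "AE s in lebesgue_on \<Delta>. f s = g s"
  shows "Lp_class p f = Lp_class p g"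
proof -
  have "(AE s in lebesgue_on \<Delta>. f s = h s) \<longleftrightarrow> (AE s in lebesgue_on \<Delta>. g s = h s)" for h
    using eq by (intro iffI; elim AE_mp[OF _ AE_mp[OF eq]]) auto
  then show ?thesis
    using assms(1,2) by (auto simp: mem_Lp_class_iff)
qed

lemma vecs_Lp: "vecs Lexp = Lp_class p ` funs"
  by (auto simp: Lp_def quotient_def Lp_class_def)

lemma vplus_Lp:
  fixes f g :: "complex \<Rightarrow> 'k::{real_normed_field, euclidean_space}"
  assumes f: "f \<in> funs" and g: "g \<in> funs"
  shows "vplus Lexp (Lp_class p f) (Lp_class p g) = Lp_class p (\<lambda>s. f s + g s)"
proof -
  have "Lp_class p (\<lambda>s. f' s + g' s) = Lp_class p (\<lambda>s. f s + g s)"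
    if "f' \<in> Lp_class p f" "g' \<in> Lp_class p g" for f' g'
  proof (rule Lp_class_eqI)
    have "AE s in lebesgue_on \<Delta>. f s = f' s" "AE s in lebesgue_on \<Delta>. g s = g' s"
      using that by (simp_all add: mem_Lp_class_iff)
    then show "AE s in lebesgue_on \<Delta>. f' s + g' s = f s + g s"
      by eventually_elim simp
  qed (use that in \<open>auto simp: mem_Lp_class_iff intro: funs_add\<close>)
  then have "(\<Union>f'\<in>Lp_class p f. \<Union>g'\<in>Lp_class p g. Lp_class p (\<lambda>s. f' s + g' s))
      = (\<Union>f'\<in>Lp_class p f. \<Union>g'\<in>Lp_class p g. Lp_class p (\<lambda>s. f s + g s))"
    by simp
  also have "\<dots> = Lp_class p (\<lambda>s. f s + g s)"
    using Lp_class_self[OF f] Lp_class_self[OF g] by auto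
  finally show ?thesis
    by (simp add: Lp_def Lp_class_def)
qed

lemma vscale_Lp:
  fixes f :: "complex \<Rightarrow> 'k::{real_normed_field, euclidean_space}"
  assumes f: "f \<in> funs"
  shows "vscale Lexp c (Lp_class p f) = Lp_class p (\<lambda>s. c * f s)"
proof -
  have "(\<Union>f'\<in>Lp_class p f. Lp_class p (\<lambda>s. c * f' s)) = Lp_class p (\<lambda>s. c * f s)"
  proof (rule UN_constant_on[OF Lp_class_self[OF f]])
    fix f' assume f': "f' \<in> Lp_class p f"
    then have "AE s in lebesgue_on \<Delta>. f s = f' s"
      by (simp add: mem_Lp_class_iff)
    then have "AE s in lebesgue_on \<Delta>. c * f' s = c * f s"
      by eventually_elim simp
    then show "Lp_class p (\<lambda>s. c * f' s) = Lp_class p (\<lambda>s. c * f s)"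
      using f' by (intro Lp_class_eqI funs_scale) (simp_all add: mem_Lp_class_iff)
  qed
  then show ?thesis
    by (simp add: Lp_def Lp_class_def)
qed

lemma vnorm_Lp:
  fixes f :: "complex \<Rightarrow> 'k::{real_normed_field, euclidean_space}"
  assumes f: "f \<in> funs"
  shows "vnorm Lexp (Lp_class p f) = enn2real (mass p f) powr (1 / p)"
proof -
  have "the_elem (Lp_fun_norm p exp_weight ` Lp_class p f) = Lp_fun_norm p exp_weight f"
  proof (rule the_elem_image_unique)
    show "Lp_class p f \<noteq> {}"
      using Lp_class_self[OF f] by blast
    fix f' assume f': "f' \<in> Lp_class p f"
    then have "mass p f = mass p f'"
      by (intro mass_cong_AE) (simp add: mem_Lp_class_iff)
    then show "Lp_fun_norm p exp_weight f' = Lp_fun_norm p exp_weight f"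
      using f' by (simp add: mem_Lp_class_iff mem_Lp_functions_iff Lp_fun_norm_eq)
  qed
  then show ?thesis
    using f by (simp add: Lp_def mem_Lp_functions_iff Lp_fun_norm_eq)
qed

text \<open>Independence of the representative follows from the mass estimate: the difference of two
  representatives has mass zero, and so does its translate.\<close>

lemma translation_Lp:
  fixes f :: "complex \<Rightarrow> 'k::{real_normed_field, euclidean_space}"
  assumes f: "f \<in> funs" and t: "t \<in> \<Delta>"
  shows "shift t (Lp_class p f) = Lp_class p (\<lambda>s. f (s + t))"
proof -
  have "(\<Union>f'\<in>Lp_class p f. Lp_class p (\<lambda>s. f' (s + t))) = Lp_class p (\<lambda>s. f (s + t))"
  proof (rule UN_constant_on[OF Lp_class_self[OF f]])
    fix f' assume "f' \<in> Lp_class p f"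
    then have f': "f' \<in> funs" and eq: "AE s in lebesgue_on \<Delta>. f s = f' s"
      by (simp_all add: mem_Lp_class_iff)
    have [measurable]: "f \<in> borel_measurable (lebesgue_on \<Delta>)" "f' \<in> borel_measurable (lebesgue_on \<Delta>)"
      using f f' by (simp_all add: mem_Lp_functions_iff)
    have [measurable]: "(\<lambda>s. f (s + t)) \<in> borel_measurable (lebesgue_on \<Delta>)"
      "(\<lambda>s. f' (s + t)) \<in> borel_measurable (lebesgue_on \<Delta>)"
      using t by (intro borel_measurable_translate_Delta; measurable)+
    have "mass p (\<lambda>s. f' s - f s) = 0"
      using eq by (subst mass_eq_0_iff) (auto elim: eventually_mono)
    moreover have "mass p (\<lambda>s. f' (s + t) - f (s + t))
        \<le> ennreal (exp (- 2 * Im t)) * mass p (\<lambda>s. f' s - f s)"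
      using t p by (intro mass_translate_Delta_le[where f = "\<lambda>s. f' s - f s"]) measurable
    ultimately have "mass p (\<lambda>s. f' (s + t) - f (s + t)) = 0"
      by simp
    then have "AE s in lebesgue_on \<Delta>. f' (s + t) = f (s + t)"
      by (subst (asm) mass_eq_0_iff) auto
    then show "Lp_class p (\<lambda>s. f' (s + t)) = Lp_class p (\<lambda>s. f (s + t))"
      using f f' t by (intro Lp_class_eqI funs_translate)
  qed
  then show ?thesis
    by (simp add: translation_def Lp_class_def)
qed

lemma vdist_Lp:
  fixes f g :: "complex \<Rightarrow> 'k::{real_normed_field, euclidean_space}"
  assumes f: "f \<in> funs" and g: "g \<in> funs"
  shows "vdist Lexp (Lp_class p f) (Lp_class p g) = enn2real (mass p (\<lambda>s. f s - g s)) powr (1 / p)"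
  unfolding vdist_def vscale_Lp[OF g] vplus_Lp[OF f funs_scale[OF g]]
    vnorm_Lp[OF funs_add[OF f funs_scale[OF g]]] by simp

lemma powr_inverse_less_iff:
  assumes "0 \<le> x" "0 < (\<epsilon>::real)"
  shows "x powr (1 / p) < \<epsilon> \<longleftrightarrow> x < \<epsilon> powr p"
proof
  assume "x powr (1 / p) < \<epsilon>"
  then have "(x powr (1 / p)) powr p < \<epsilon> powr p"
    using p by (intro powr_less_mono2) auto
  then show "x < \<epsilon> powr p"
    using p assms by (simp add: powr_powr)
next
  assume "x < \<epsilon> powr p"
  then have "x powr (1 / p) < (\<epsilon> powr p) powr (1 / p)"
    using p assms by (intro powr_less_mono2) auto
  then show "x powr (1 / p) < \<epsilon>"
    using p assms by (simp add: powr_powr)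
qed

text \<open>The dictionary through which estimates of \<open>mass\<close> with
  \<open>\<epsilon> powr p\<close> become statements about the metric.\<close>

lemma vdist_Lp_less_iff:
  fixes f g :: "complex \<Rightarrow> 'k::{real_normed_field, euclidean_space}"
  assumes f: "f \<in> funs" and g: "g \<in> funs" and \<epsilon>: "0 < \<epsilon>"
  shows "vdist Lexp (Lp_class p f) (Lp_class p g) < \<epsilon> \<longleftrightarrow> mass p (\<lambda>s. f s - g s) < ennreal (\<epsilon> powr p)"
proof -
  have "mass p (\<lambda>s. f s - g s) < \<infinity>"
    using funs_diff[OF f g] by (simp add: mem_Lp_functions_iff)
  then obtain x where x: "0 \<le> x" "mass p (\<lambda>s. f s - g s) = ennreal x"
    by (cases "mass p (\<lambda>s. f s - g s)") auto
  show ?thesis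
    unfolding vdist_Lp[OF f g] x(2) using x(1) \<epsilon>
    by (simp add: powr_inverse_less_iff ennreal_less_iff)
qed

section \<open>The translation semigroup\<close>

lemma C0_semigroup_translation:
  "C0_semigroup (Lexp :: ('k::{real_normed_field, euclidean_space}, _) normed_space) shift"
  unfolding C0_semigroup_def
proof (intro conjI ballI)
  fix t :: complex assume t: "t \<in> \<Delta>"
  show "bounded_operator Lexp (shift t :: (complex \<Rightarrow> 'k) set \<Rightarrow> _)"
    unfolding bounded_operator_def vecs_Lp
  proof (intro conjI allI ballI)
    fix F :: "(complex \<Rightarrow> 'k) set" assume "F \<in> Lp_class p ` funs"
    then obtain f where f: "f \<in> funs" "F = Lp_class p f" by blast
    show "shift t F \<in> Lp_class p ` funs"
      using f t by (simp add: translation_Lp funs_translate)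
    show "shift t (vscale Lexp c F) = vscale Lexp c (shift t F)" for c
      using f t by (simp add: translation_Lp vscale_Lp funs_translate funs_scale)
    fix G :: "(complex \<Rightarrow> 'k) set" assume "G \<in> Lp_class p ` funs"
    then obtain g where g: "g \<in> funs" "G = Lp_class p g" by blast
    show "shift t (vplus Lexp F G) = vplus Lexp (shift t F) (shift t G)"
      using f g t by (simp add: translation_Lp vplus_Lp funs_translate funs_add)
  next
    show "\<exists>C. \<forall>F\<in>Lp_class p ` (funs :: (complex \<Rightarrow> 'k) set). vnorm Lexp (shift t F) \<le> C * vnorm Lexp F"
    proof (intro exI ballI)
      fix F :: "(complex \<Rightarrow> 'k) set" assume "F \<in> Lp_class p ` funs"
      then obtain f where f: "f \<in> funs" "F = Lp_class p f" by blast
      then have fin: "mass p f < \<infinity>" and meas: "f \<in> borel_measurable (lebesgue_on \<Delta>)"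
        by (simp_all add: mem_Lp_functions_iff)
      have "enn2real (mass p (\<lambda>s. f (s + t))) \<le> enn2real (ennreal (exp (- 2 * Im t)) * mass p f)"
        using fin by (intro enn2real_mono mass_translate_Delta_le meas t p)
          (simp add: ennreal_mult_less_top)
      also have "\<dots> = exp (- 2 * Im t) * enn2real (mass p f)"
        by (simp add: enn2real_mult)
      finally have "enn2real (mass p (\<lambda>s. f (s + t))) powr (1 / p)
          \<le> (exp (- 2 * Im t) * enn2real (mass p f)) powr (1 / p)"
        using p by (intro powr_mono2) auto
      then show "vnorm Lexp (shift t F) \<le> exp (- 2 * Im t) powr (1 / p) * vnorm Lexp F"
        using f t by (simp add: translation_Lp vnorm_Lp funs_translate powr_mult)
    qed
  qed
next
  fix F :: "(complex \<Rightarrow> 'k) set" assume "F \<in> vecs Lexp"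
  then obtain f where f: "f \<in> funs" "F = Lp_class p f" by (auto simp: vecs_Lp)
  show "shift 0 F = F"
    using f by (simp add: translation_Lp zero_in_Delta)
  fix t assume t: "t \<in> \<Delta>"
  show "((\<lambda>s. vdist Lexp (shift s F) (shift t F)) \<longlongrightarrow> 0) (at t within \<Delta>)"
  proof (rule tendstoI)
    fix e :: real assume e: "0 < e"
    have "\<forall>\<^sub>F s in at t within \<Delta>. mass p (\<lambda>u. f (u + s) - f (u + t)) < ennreal (e powr p)"
      using f(1) t p e
      by (intro order_tendstoD(2)[OF mass_translate_continuous]) (auto simp: mem_Lp_functions_iff)
    moreover have "\<forall>\<^sub>F s in at t within \<Delta>. s \<in> \<Delta>"
      by (simp add: eventually_at_filter)
    ultimately show "\<forall>\<^sub>F s in at t within \<Delta>. dist (vdist Lexp (shift s F) (shift t F)) 0 < e"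
    proof eventually_elim
      case (elim s)
      then have "vdist Lexp (shift s F) (shift t F) < e"
        using f t e by (simp add: translation_Lp vdist_Lp_less_iff funs_translate)
      moreover have "0 \<le> vdist Lexp (shift s F) (shift t F)"
        using f t elim by (simp add: translation_Lp vdist_Lp funs_translate)
      ultimately show ?case by simp
    qed
  qed
next
  fix t s :: complex and F :: "(complex \<Rightarrow> 'k) set"
  assume ts: "t \<in> \<Delta>" "s \<in> \<Delta>" and "F \<in> vecs Lexp"
  then obtain f where f: "f \<in> funs" "F = Lp_class p f" by (auto simp: vecs_Lp)
  then show "shift t (shift s F) = shift (t + s) F"
    using ts by (simp add: translation_Lp funs_translate Delta_add add.assoc)
qed

section \<open>A dense orbit\<close>

lemma hypercyclic_translation:
  "hypercyclic (Lexp :: ('k::{real_normed_field, euclidean_space}, _) normed_space) shift"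
proof -
  obtain d :: "nat \<Rightarrow> complex \<Rightarrow> 'k"
    where d_meas: "\<forall>n. d n \<in> borel_measurable (lebesgue_on \<Delta>)"
      and d_supp: "\<forall>n. \<exists>R\<ge>0. \<forall>s. R \<le> Re s \<longrightarrow> d n s = 0"
      and d_fin: "\<forall>n. mass p (d n) < \<infinity>"
      and d_dense: "\<forall>f\<in>borel_measurable (lebesgue_on \<Delta>). mass p f < \<infinity> \<longrightarrow>
        (\<forall>\<epsilon>>0. \<exists>n. mass p (\<lambda>s. f s - d n s) < ennreal \<epsilon>)"
    by (rule countable_dense_family[OF p])
  obtain r where "\<forall>n. 0 \<le> r n \<and> (\<forall>s. r n \<le> Re s \<longrightarrow> d n s = 0)"
    using d_supp by metis
  then have r: "0 \<le> r n" "r n \<le> Re s \<Longrightarrow> d n s = 0" for n s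
    by blast+
  \<comment> \<open>The first component of \<open>prod_decode\<close> takes every value infinitely
    often, so each member of the dense family recurs at arbitrarily late positions.\<close>
  define g where "g n s = (if s \<in> \<Delta> then d (fst (prod_decode n)) s else 0)" for n s
  define R where "R n = r (fst (prod_decode n))" for n
  define N where "N n = enn2real (mass p (g n))" for n
  \<comment> \<open>The gap before copy \<open>n\<close>, chosen so that
    \<open>exp (- L n) * N n \<le> 1 / 2 ^ n\<close>. Adding 1 to \<open>N n\<close> keeps the
    argument of \<open>ln\<close> at least 1, so gaps are nonnegative.\<close>
  define L where "L n = ln (2 ^ n * (N n + 1))" for n
  define a where "a = rec_nat 0 (\<lambda>n x. x + R n + L (Suc n))"
  have a: "a 0 = 0" "a (Suc n) = a n + R n + L (Suc n)" for n
    by (simp_all add: a_def)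
  have N: "0 \<le> N n" for n
    by (simp add: N_def)
  have "1 * 1 \<le> 2 ^ n * (N n + 1)" for n
    using N by (intro mult_mono) auto
  then have L: "0 \<le> L n" for n
    by (simp add: L_def)
  interpret gluing p g a R
  proof
    show "g n \<in> borel_measurable (lebesgue_on \<Delta>)" for n
      unfolding g_def by (rule borel_measurable_cutoff_Delta) (rule d_meas[rule_format])
  qed (use p r L in \<open>auto simp: g_def R_def a\<close>)
  have g_mass: "mass p (g n) = mass p (d (fst (prod_decode n)))" for n
    by (rule mass_cong) (simp add: g_def)
  have mass_N: "mass p (g n) = ennreal (N n)" for n
    using d_fin[rule_format, of "fst (prod_decode n)"] by (simp add: N_def g_mass less_top)
  have term_le: "ennreal (exp (- 2 * (a (m + 1 + k) - a m))) * mass p (g (m + 1 + k))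
      \<le> ennreal ((1/2) ^ m * (1/2) ^ Suc k)" for m k
  proof -
    let ?n = "m + 1 + k"
    \<comment> \<open>The last gap before the copy is already enough for its bound, whatever the
      earlier distances are.\<close>
    have "L ?n \<le> a ?n - a m"
      using a(2)[of "m + k"] a_mono[of m "m + k"] R[of "m + k"] by simp
    then have "exp (- 2 * (a ?n - a m)) \<le> exp (- L ?n)"
      using L[of ?n] by simp
    also have "\<dots> = inverse (2 ^ ?n * (N ?n + 1))"
      using N[of ?n] by (simp add: L_def exp_minus del: power_Suc)
    finally have "exp (- 2 * (a ?n - a m)) * N ?n \<le> inverse (2 ^ ?n * (N ?n + 1)) * (N ?n + 1)"
      using N[of ?n] by (intro mult_mono) auto
    also have "\<dots> = inverse (2 ^ ?n)"
      using N[of ?n] by (simp del: power_Suc)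
    also have "\<dots> = (1/2) ^ (m + Suc k)"
      by (simp only: power_one_over inverse_eq_divide add_Suc_right Suc_eq_plus1 add_ac)
    also have "\<dots> = (1/2) ^ m * (1/2) ^ Suc k"
      by (rule power_add)
    finally show ?thesis
      unfolding mass_N by (subst ennreal_mult'[symmetric]) (auto intro: ennreal_leI N)
  qed
  have mass_le: "mass p (\<lambda>s. glued (s + ray (a m)) - g m s) \<le> ennreal ((1/2) ^ m)" for m
  proof -
    have "(\<lambda>k. (1/2) ^ m * (1/2::real) ^ Suc k) sums ((1/2) ^ m * 1)"
      by (intro sums_mult power_half_series)
    then have sum: "(\<Sum>k. ennreal ((1/2) ^ m * (1/2) ^ Suc k)) = ennreal ((1/2) ^ m)"
      by (intro suminf_ennreal_eq) auto
    have "mass p (\<lambda>s. glued (s + ray (a m)) - g m s) \<le>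
        (\<Sum>k. ennreal (exp (- 2 * (a (m + 1 + k) - a m))) * mass p (g (m + 1 + k)))"
      by (rule mass_glued_le)
    also have "\<dots> \<le> (\<Sum>k. ennreal ((1/2) ^ m * (1/2) ^ Suc k))"
      by (intro suminf_le term_le summableI)
    finally show ?thesis
      unfolding sum .
  qed
  have g_funs: "g n \<in> funs" for n
    using meas[of n] mass_N[of n] by (simp add: mem_Lp_functions_iff)
  \<comment> \<open>The case \<open>m = 0\<close> of the tail estimate shows that
    \<open>glued\<close> belongs to the space.\<close>
  have "ray 0 = 0"
    by (simp add: complex_eq_iff)
  then have "mass p (\<lambda>s. glued s - g 0 s) < \<infinity>"
    using mass_le[of 0] by (simp add: a0 order_le_less_trans)
  then have "(\<lambda>s. glued s - g 0 s) \<in> funs"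
    using borel_measurable_glued meas by (simp add: mem_Lp_functions_iff)
  from funs_add[OF this g_funs[of 0]] have F: "glued \<in> funs"
    by simp
  have a_nonneg: "0 \<le> a n" for n
    using a_mono[of 0 n] a0 by simp
  show ?thesis
    unfolding hypercyclic_def
  proof (intro bexI)
    show "Lp_class p glued \<in> vecs Lexp"
      using F by (simp add: vecs_Lp)
    show "dense_in Lexp {shift t (Lp_class p glued) |t. t \<in> \<Delta>}"
      unfolding dense_in_def
    proof (intro conjI ballI allI impI)
      show "{shift t (Lp_class p glued) |t. t \<in> \<Delta>} \<subseteq> vecs Lexp"
        using F by (auto simp: vecs_Lp translation_Lp funs_translate)
      fix G :: "(complex \<Rightarrow> 'k) set" and \<epsilon> :: real assume "G \<in> vecs Lexp" and \<epsilon>: "0 < \<epsilon>"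
      then obtain f where f: "f \<in> funs" "G = Lp_class p f" by (auto simp: vecs_Lp)
      define \<eta> where "\<eta> = \<epsilon> powr p / (4 * 2 powr p)"
      have \<eta>: "0 < \<eta>" using \<epsilon> by (simp add: \<eta>_def)
      obtain j where j: "mass p (\<lambda>s. f s - d j s) < ennreal \<eta>"
        using d_dense \<eta> f(1) unfolding mem_Lp_functions_iff by blast
      obtain i where i: "(1/2) ^ i < \<eta>"
        using real_arch_pow_inv[OF \<eta>, of "1/2"] by auto
      \<comment> \<open>\<open>j\<close> selects the approximant and \<open>i\<close> the accuracy:
        the position coding both is at least \<open>i\<close>, so the tail after it is at most
        \<open>(1/2) ^ i\<close>.\<close>
      define m where "m = prod_encode (j, i)"
      have "(1/2::real) ^ m \<le> (1/2) ^ i"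
        unfolding m_def by (intro power_decreasing le_prod_encode_2) auto
      then have "ennreal ((1/2) ^ m) \<le> ennreal \<eta>"
        using i by (intro ennreal_leI) linarith
      then have 1: "mass p (\<lambda>s. g m s - glued (s + ray (a m))) \<le> ennreal \<eta>"
        using mass_le[of m] mass_minus_commute[of p "g m"] by (metis order_trans)
      have 2: "mass p (\<lambda>s. f s - g m s) \<le> ennreal \<eta>"
        using j mass_cong[of "\<lambda>s. f s - g m s" "\<lambda>s. f s - d j s" p] by (simp add: g_def m_def)
      have shifted: "(\<lambda>s. glued (s + ray (a m))) \<in> funs"
        using F by (intro funs_translate ray_in_Delta a_nonneg)
      have "mass p (\<lambda>s. f s - glued (s + ray (a m))) < ennreal (\<epsilon> powr p)"
        using 1 2 p \<epsilon> f(1) shifted meas[of m] unfolding \<eta>_def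
        by (intro mass_diff_less[where g = "g m"]) (auto simp: mem_Lp_functions_iff)
      then have "vdist Lexp G (shift (ray (a m)) (Lp_class p glued)) < \<epsilon>"
        using f F shifted \<epsilon> by (simp add: translation_Lp ray_in_Delta a_nonneg vdist_Lp_less_iff)
      then show "\<exists>H\<in>{shift t (Lp_class p glued) |t. t \<in> \<Delta>}. vdist Lexp G H < \<epsilon>"
        using ray_in_Delta[OF a_nonneg] by blast
    qed
  qed
qed

section \<open>Density of the periodic points\<close>

lemma dense_periodic_points_translation:
  "dense_in (Lexp :: ('k::{real_normed_field, euclidean_space}, _) normed_space) (periodic_points Lexp shift)"
  unfolding dense_in_def
proof (intro conjI ballI allI impI)
  show "periodic_points Lexp shift \<subseteq> vecs (Lexp :: ('k, _) normed_space)"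
    by (auto simp: periodic_points_def)
  fix G :: "(complex \<Rightarrow> 'k) set" and \<epsilon> :: real assume "G \<in> vecs Lexp" and \<epsilon>: "0 < \<epsilon>"
  then obtain f where f: "f \<in> funs" "G = Lp_class p f" by (auto simp: vecs_Lp)
  define \<eta> where "\<eta> = \<epsilon> powr p / (4 * 2 powr p)"
  have \<eta>: "0 < \<eta>" using \<epsilon> by (simp add: \<eta>_def)
  obtain e :: "nat \<Rightarrow> complex \<Rightarrow> 'k"
    where e: "\<forall>n. e n \<in> borel_measurable (lebesgue_on \<Delta>)"
      "\<forall>n. \<exists>R\<ge>0. \<forall>s. R \<le> Re s \<longrightarrow> e n s = 0"
      "\<forall>n. mass p (e n) < \<infinity>"
      "\<forall>f\<in>borel_measurable (lebesgue_on \<Delta>). mass p f < \<infinity> \<longrightarrow>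
        (\<forall>\<epsilon>>0. \<exists>n. mass p (\<lambda>s. f s - e n s) < ennreal \<epsilon>)"
    by (rule countable_dense_family[OF p])
  obtain j where "mass p (\<lambda>s. f s - e j s) < ennreal \<eta>"
    using e(4) \<eta> f(1) unfolding mem_Lp_functions_iff by blast
  moreover obtain r where "0 \<le> r" "\<forall>s. r \<le> Re s \<longrightarrow> e j s = 0"
    using e(2) by blast
  moreover define d where "d = e j"
  ultimately have d_meas: "d \<in> borel_measurable (lebesgue_on \<Delta>)"
    and r: "0 \<le> r" "\<And>s. r \<le> Re s \<Longrightarrow> d s = 0"
    and d_fin: "mass p d < \<infinity>" and d: "mass p (\<lambda>s. f s - d s) < ennreal \<eta>"
    using e(1,3) by simp_all
  define h where "h s = (if s \<in> \<Delta> then d s else 0)" for s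
  define N where "N = enn2real (mass p h)"
  have N: "0 \<le> N"
    by (simp add: N_def)
  have "mass p h = mass p d"
    by (rule mass_cong) (simp add: h_def)
  then have mass_N: "mass p h = ennreal N"
    using d_fin by (simp add: N_def less_top)
  \<comment> \<open>\<open>r\<close> keeps the copies disjoint, the logarithm makes the later copies
    together at most \<open>\<eta>\<close>, and 1 gives geometric decay and a nonzero
    period.\<close>
  define c where "c = max (max 1 r) (ln ((N + 1) / \<eta>))"
  have c: "1 \<le> c" "r \<le> c" "ln ((N + 1) / \<eta>) \<le> c"
    by (simp_all add: c_def)
  interpret gluing p "\<lambda>_. h" "\<lambda>n. real n * c" "\<lambda>_. r"
  proof
    show "h \<in> borel_measurable (lebesgue_on \<Delta>)"
      unfolding h_def by (rule borel_measurable_cutoff_Delta) (rule d_meas)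
  qed (use p r c in \<open>auto simp: h_def algebra_simps\<close>)
  have "(N + 1) / \<eta> = exp (ln ((N + 1) / \<eta>))"
    using N \<eta> by simp
  also have "\<dots> \<le> exp c"
    using c(3) by simp
  finally have "(N + 1) / \<eta> \<le> exp c" .
  then have c\<eta>: "exp (- c) * N \<le> \<eta>"
    using N \<eta> by (simp add: exp_minus field_simps)
  have exp_1: "exp (- 1 :: real) \<le> 1 / 2"
    using exp_ge_add_one_self[of "1::real"] by (simp add: exp_minus field_simps)
  have term_le: "ennreal (exp (- 2 * (real (0 + 1 + k) * c - real 0 * c))) * mass p h
      \<le> ennreal (exp (- c) * N * (1/2) ^ Suc k)" for k
  proof -
    define x where "x = real (0 + 1 + k) * c - real 0 * c"
    have "real (Suc k) * 1 \<le> real (Suc k) * c" "1 * c \<le> real (Suc k) * c"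
      using c(1) by (intro mult_left_mono mult_right_mono; simp)+
    then have "real (Suc k) \<le> x" "c \<le> x"
      by (simp_all add: x_def)
    \<comment> \<open>The doubled exponent is split: one \<open>x\<close> is bounded below by
      \<open>c\<close> and beats the mass of \<open>h\<close>, the other by \<open>Suc k\<close> and
      makes the series converge.\<close>
    then have "- 2 * x \<le> - c - real (Suc k)"
      by linarith
    then have "exp (- 2 * x) \<le> exp (- c + real (Suc k) * (- 1))"
      by (simp del: of_nat_Suc)
    also have "\<dots> = exp (- c) * exp (- 1) ^ Suc k"
      by (simp only: exp_add exp_of_nat_mult)
    also have "\<dots> \<le> exp (- c) * (1/2) ^ Suc k"
      by (intro mult_left_mono power_mono exp_1) auto
    finally have "exp (- 2 * x) * N \<le> exp (- c) * (1/2) ^ Suc k * N"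
      using N by (intro mult_right_mono)
    then show ?thesis
      unfolding x_def mass_N by (subst ennreal_mult'[symmetric]) (auto intro: ennreal_leI N simp: mult_ac)
  qed
  have "(\<lambda>k. exp (- c) * N * (1/2::real) ^ Suc k) sums (exp (- c) * N * 1)"
    by (intro sums_mult power_half_series)
  then have sum: "(\<Sum>k. ennreal (exp (- c) * N * (1/2) ^ Suc k)) = ennreal (exp (- c) * N)"
    using N by (intro suminf_ennreal_eq) auto
  have "ray (real 0 * c) = 0"
    by (simp add: complex_eq_iff)
  then have "mass p (\<lambda>s. glued s - h s) = mass p (\<lambda>s. glued (s + ray (real 0 * c)) - h s)"
    by simp
  also have "\<dots> \<le> (\<Sum>k. ennreal (exp (- 2 * (real (0 + 1 + k) * c - real 0 * c))) * mass p h)"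
    by (rule mass_glued_le)
  also have "\<dots> \<le> (\<Sum>k. ennreal (exp (- c) * N * (1/2) ^ Suc k))"
    by (intro suminf_le term_le summableI)
  also have "\<dots> = ennreal (exp (- c) * N)"
    by (rule sum)
  also have "\<dots> \<le> ennreal \<eta>"
    using c\<eta> by (rule ennreal_leI)
  finally have 1: "mass p (\<lambda>s. glued s - h s) \<le> ennreal \<eta>" .
  have h_funs: "h \<in> funs"
    using meas mass_N by (simp add: mem_Lp_functions_iff)
  have "(\<lambda>s. glued s - h s) \<in> funs"
    using 1 borel_measurable_glued meas by (simp add: mem_Lp_functions_iff order_le_less_trans)
  from funs_add[OF this h_funs] have F: "glued \<in> funs"
    by simp
  have "mass p (\<lambda>s. f s - h s) \<le> ennreal \<eta>"
    using d mass_cong[of "\<lambda>s. f s - h s" "\<lambda>s. f s - d s" p] by (simp add: h_def)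
  then have "mass p (\<lambda>s. f s - glued s) < ennreal (\<epsilon> powr p)"
    using 1 p \<epsilon> f(1) F meas mass_minus_commute[of p h glued] unfolding \<eta>_def
    by (intro mass_diff_less[where g = h]) (auto simp: mem_Lp_functions_iff)
  then have close: "vdist Lexp G (Lp_class p glued) < \<epsilon>"
    using f F \<epsilon> by (simp add: vdist_Lp_less_iff)
  have ray_c: "ray c \<in> \<Delta>"
    using c(1) by (intro ray_in_Delta) simp
  have "Lp_class p (\<lambda>s. glued (s + ray c)) = Lp_class p glued"
    using F ray_c by (intro Lp_class_eqI funs_translate AE_I2) (auto intro: glued_periodic)
  then have "shift (ray c) (Lp_class p glued) = Lp_class p glued"
    using F ray_c by (simp add: translation_Lp)
  moreover have "ray c \<noteq> 0"
    using c(1) by (auto simp: complex_eq_iff)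
  ultimately have "Lp_class p glued \<in> periodic_points Lexp shift"
    using F ray_c by (auto simp: periodic_points_def vecs_Lp)
  with close show "\<exists>H\<in>periodic_points Lexp shift. vdist Lexp G H < \<epsilon>" ..
qed

end

section \<open>Failure of distributional chaos\<close>

lemma measure_complex_cbox:
  assumes "a \<le> b" "c \<le> d"
  shows "measure lebesgue (cbox (Complex a c) (Complex b d)) = (b - a) * (d - c)"
proof -
  have "Complex a c \<in> cbox (Complex a c) (Complex b d)"
    using assms by (simp add: in_cbox_complex_iff)
  then have "cbox (Complex a c) (Complex b d) \<noteq> {}"
    by blast
  then show ?thesis
    by (simp add: content_cbox_if Basis_complex_def)
qed

lemma lmeasurable_Delta_below: "Delta_below r \<in> lmeasurable"
proof -
  have "Delta_below r = ball 0 r \<inter> \<Delta>"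
    by (auto simp: Delta_below_def)
  then show ?thesis
    by (simp add: fmeasurable_Int_fmeasurable)
qed

text \<open>A box inside the sector that scales with \<open>r\<close> eventually lies above any
  fixed horizontal line, so the set misses a fixed proportion of
  \<open>Delta_below r\<close>.\<close>

lemma upper_density_below_line_less_1:
  assumes A: "A \<subseteq> {t. Im t < c}"
  shows "upper_density A < 1"
proof -
  have "\<forall>\<^sub>F r in at_top. ereal (measure lebesgue (A \<inter> Delta_below r) / measure lebesgue (Delta_below r))
      \<le> ereal (31 / 32)"
    using eventually_gt_at_top[of "max 0 (4 * c)"]
  proof eventually_elim
    case (elim r)
    \<comment> \<open>For \<open>r > 4 * c\<close> this box is above the line. Its farthest corner
      has squared norm \<open>13 / 16 * r\<^sup>2\<close> and its area is
      \<open>r\<^sup>2 / 16\<close>; against the crude bound \<open>2 * r\<^sup>2\<close> for the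
      whole region this is the missing share \<open>1 / 32\<close>.\<close>
    let ?E = "cbox (Complex (r / 2) (r / 4)) (Complex (3 * r / 4) (r / 2))"
    have E: "?E \<subseteq> Delta_below r"
    proof
      fix t assume t: "t \<in> ?E"
      then have \<Delta>: "t \<in> \<Delta>"
        by (auto simp: mem_Delta_iff in_cbox_complex_iff)
      have "(Re t)\<^sup>2 + (Im t)\<^sup>2 \<le> (3 * r / 4)\<^sup>2 + (r / 2)\<^sup>2"
        using t elim by (intro add_mono power_mono) (auto simp: in_cbox_complex_iff)
      then have "(norm t)\<^sup>2 \<le> 13 / 16 * r\<^sup>2"
        unfolding cmod_power2 by (simp add: power_divide power_mult_distrib)
      also have "\<dots> < r\<^sup>2"
        using elim by simp
      finally have "norm t < r"
        by (rule power2_less_imp_less) (use elim in simp)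
      with \<Delta> show "t \<in> Delta_below r"
        by (simp add: Delta_below_def)
    qed
    have mE: "measure lebesgue ?E = r\<^sup>2 / 16"
      using elim by (subst measure_complex_cbox) (auto simp: power2_eq_square field_simps)
    have "Delta_below r \<subseteq> cbox (Complex 0 (- r)) (Complex r r)"
    proof
      fix t assume "t \<in> Delta_below r"
      then show "t \<in> cbox (Complex 0 (- r)) (Complex r r)"
        using complex_Re_le_cmod[of t]
        by (auto simp: Delta_below_def mem_Delta_iff in_cbox_complex_iff)
    qed
    then have "measure lebesgue (Delta_below r) \<le> measure lebesgue (cbox (Complex 0 (- r)) (Complex r r))"
      by (intro measure_mono_fmeasurable fmeasurableD lmeasurable_Delta_below) auto
    also have "\<dots> = 2 * r\<^sup>2"
      using elim by (subst measure_complex_cbox) (auto simp: power2_eq_square)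
    finally have le: "measure lebesgue (Delta_below r) \<le> 2 * r\<^sup>2" .
    have "measure lebesgue ?E \<le> measure lebesgue (Delta_below r)"
      by (intro measure_mono_fmeasurable E lmeasurable_Delta_below) auto
    moreover have "0 < r\<^sup>2"
      using elim by simp
    ultimately have pos: "0 < measure lebesgue (Delta_below r)"
      using mE by linarith
    have "measure lebesgue (A \<inter> Delta_below r) \<le> measure lebesgue (Delta_below r - ?E)"
    \<comment> \<open>\<open>A\<close> is an arbitrary set; a non-measurable intersection has
      \<open>measure\<close> 0 by default.\<close>
    proof (cases "A \<inter> Delta_below r \<in> sets lebesgue")
      case True
      have "A \<inter> Delta_below r \<subseteq> Delta_below r - ?E"
        using A elim by (force simp: in_cbox_complex_iff)
      then show ?thesis
        using True fmeasurable_Diff[OF lmeasurable_Delta_below, of ?E r]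
        by (intro measure_mono_fmeasurable) simp_all
    qed (simp add: measure_notin_sets)
    also have "\<dots> = measure lebesgue (Delta_below r) - r\<^sup>2 / 16"
      using E mE lmeasurable_Delta_below by (subst measurable_measure_Diff) auto
    also have "\<dots> \<le> 31 / 32 * measure lebesgue (Delta_below r)"
      using le by simp
    finally show ?case
      using pos by (simp add: pos_divide_le_eq)
  qed
  then have "upper_density A \<le> ereal (31 / 32)"
    unfolding upper_density_def by (rule Limsup_bounded)
  also have "\<dots> < 1" by (simp add: one_ereal_def)
  finally show ?thesis .
qed

text \<open>The obstruction hits every single pair: a distance above \<open>\<delta>\<close> forces
  \<open>exp (- 2 * Im t)\<close> times the mass of \<open>f - g\<close> to be at least
  \<open>\<delta> powr p\<close>, which bounds \<open>Im t\<close> from above.\<close>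

lemma not_distributionally_chaotic_translation:
  assumes p: "0 < p"
  shows "\<not> distributionally_chaotic
    (Lp p exp_weight :: ('k::{real_normed_field, euclidean_space}, _) normed_space)
    (translation p exp_weight)"
proof
  let ?X = "Lp p exp_weight :: ('k, _) normed_space" and ?T = "translation p exp_weight"
  assume "distributionally_chaotic ?X ?T"
  then obtain S where S: "S \<subseteq> vecs ?X" "uncountable S"
    and pairs: "\<And>F G. F \<in> S \<Longrightarrow> G \<in> S \<Longrightarrow> F \<noteq> G \<Longrightarrow> distributionally_chaotic_pair ?X ?T F G"
    unfolding distributionally_chaotic_def by blast
  obtain F where F: "F \<in> S"
    using S(2) by (metis all_not_in_conv countable_empty)
  have "uncountable (S - {F})"
    using S(2) uncountable_minus_countable by blast
  then obtain G where G: "G \<in> S" "F \<noteq> G"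
    by (metis Diff_iff all_not_in_conv countable_empty insertI1)
  obtain \<delta> where \<delta>: "0 < \<delta>" and dens: "upper_density {t \<in> \<Delta>. vdist ?X (?T t F) (?T t G) > \<delta>} = 1"
    using pairs[OF F G] unfolding distributionally_chaotic_pair_def by blast
  obtain f g where f: "f \<in> Lp_functions p exp_weight" "F = Lp_class p f"
    and g: "g \<in> Lp_functions p exp_weight" "G = Lp_class p g"
    using F G(1) S(1) unfolding vecs_Lp[OF p] by blast
  define N where "N = enn2real (mass p (\<lambda>s. f s - g s))"
  have N: "0 \<le> N"
    by (simp add: N_def)
  have fg: "(\<lambda>s. f s - g s) \<in> Lp_functions p exp_weight"
    using funs_diff[OF p f(1) g(1)] .
  then have mass_N: "mass p (\<lambda>s. f s - g s) = ennreal N"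
    by (simp add: N_def mem_Lp_functions_iff less_top)
  \<comment> \<open>\<open>N + 1\<close> keeps the logarithm meaningful when \<open>N\<close> is 0,
    and the final 1 makes the inequality strict.\<close>
  have "Im t < ln ((N + 1) / \<delta> powr p) / 2 + 1"
    if t: "t \<in> \<Delta>" and gt: "vdist ?X (?T t F) (?T t G) > \<delta>" for t
  proof -
    have "\<not> mass p (\<lambda>s. f (s + t) - g (s + t)) < ennreal (\<delta> powr p)"
      using gt f g t \<delta> p
      by (simp add: translation_Lp funs_translate flip: vdist_Lp_less_iff)
    then have "ennreal (\<delta> powr p) \<le> ennreal (exp (- 2 * Im t)) * ennreal N"
      using mass_translate_Delta_le[of "\<lambda>s. f s - g s" t p] fg t p
      unfolding mass_N mem_Lp_functions_iff by (simp add: not_less)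
    also have "\<dots> = ennreal (exp (- 2 * Im t) * N)"
      by (simp add: ennreal_mult')
    finally have "\<delta> powr p \<le> exp (- 2 * Im t) * N"
      using N by (simp add: ennreal_le_iff)
    also have "\<dots> \<le> exp (- 2 * Im t) * (N + 1)"
      by (intro mult_left_mono) auto
    finally have "exp (2 * Im t) \<le> (N + 1) / \<delta> powr p"
      using \<delta> by (simp add: exp_minus field_simps)
    then have "2 * Im t \<le> ln ((N + 1) / \<delta> powr p)"
      using N \<delta> by (subst ln_ge_iff) auto
    then show ?thesis by simp
  qed
  then have "{t \<in> \<Delta>. vdist ?X (?T t F) (?T t G) > \<delta>} \<subseteq> {t. Im t < ln ((N + 1) / \<delta> powr p) / 2 + 1}"
    by blast
  from upper_density_below_line_less_1[OF this] dens show False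
    by simp
qed

text \<open>The constants are 1 and 2, because adding \<open>t'\<close> lowers the imaginary part by
  at most \<open>norm t'\<close>.\<close>

lemma admissible_exp_weight:
  assumes v: "\<And>s. s \<in> \<Delta> \<Longrightarrow> v s = exp (2 * Im s)"
  shows "admissible_weight v"
  unfolding admissible_weight_def
proof (intro conjI ballI exI)
  show "v \<in> borel_measurable (lebesgue_on \<Delta>)"
    using borel_measurable_weight v by (subst measurable_cong) auto
  show "0 < v t" if "t \<in> \<Delta>" for t
    using v[OF that] by simp
  show "v t \<le> 1 * exp (2 * norm t') * v (t + t')" if "t \<in> \<Delta>" "t' \<in> \<Delta>" for t t'
    using v[OF that(1)] v[OF Delta_add[OF that]] abs_Im_le_cmod[of t']
    by (simp flip: exp_add)
qed simp

theorem mainTheorem7: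
  fixes p :: real and v :: "complex \<Rightarrow> real"
  assumes "1 \<le> p"
    and "\<And>x y. Complex x y \<in> \<Delta> \<Longrightarrow> v (Complex x y) = exp (2 * y)"
  shows "admissible_weight v \<and>
     C0_semigroup (Lp p v :: (real, (complex \<Rightarrow> real) set) normed_space) (translation p v) \<and>
     devaney_chaotic (Lp p v :: (real, (complex \<Rightarrow> real) set) normed_space) (translation p v) \<and>
     \<not> distributionally_chaotic (Lp p v :: (real, (complex \<Rightarrow> real) set) normed_space) (translation p v) \<and>
     C0_semigroup (Lp p v :: (complex, (complex \<Rightarrow> complex) set) normed_space) (translation p v) \<and>
     devaney_chaotic (Lp p v :: (complex, (complex \<Rightarrow> complex) set) normed_space) (translation p v) \<and>
     \<not> distributionally_chaotic (Lp p v :: (complex, (complex \<Rightarrow> complex) set) normed_space) (translation p v)"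
proof -
  have p: "0 < p" using assms(1) by simp
  have v: "v s = exp (2 * Im s)" if "s \<in> \<Delta>" for s
    using assms(2)[of "Re s" "Im s"] that by simp
  \<comment> \<open>The generic results are instantiated at both scalar fields; the change of weight
    has to be recorded once for each type.\<close>
  have real: "Lp p v = (Lp p exp_weight :: (real, (complex \<Rightarrow> real) set) normed_space)"
    "translation p v = (translation p exp_weight :: complex \<Rightarrow> (complex \<Rightarrow> real) set \<Rightarrow> _)"
    using v by (intro Lp_weight_cong; simp)+
  have complex: "Lp p v = (Lp p exp_weight :: (complex, (complex \<Rightarrow> complex) set) normed_space)"
    "translation p v = (translation p exp_weight :: complex \<Rightarrow> (complex \<Rightarrow> complex) set \<Rightarrow> _)"
    using v by (intro Lp_weight_cong; simp)+
  show ?thesis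
    unfolding real complex devaney_chaotic_def
    by (intro conjI admissible_exp_weight[OF v] C0_semigroup_translation[OF p]
        hypercyclic_translation[OF p] dense_periodic_points_translation[OF p]
        not_distributionally_chaotic_translation[OF p])
qed

end
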